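(* Let $R=k[x_1,\ldots,x_n]$ be a polynomial ring over a field $k$ with its standard grading and let $M$ be a finitely generated graded $R$-module. Let $\operatorname{reg}(M)=\max\{b_i(M)-i \mid i\ge 0\}$ be the Castelnuovo-Mumford regularity of $M$ defined via its minimal graded free resolution. Then $$\operatorname{reg}(M)=\max\{t\in\mathbb Z \mid \operatorname{Tor}_i^R(M,k)_{t+i}\neq 0 \text{ for some } i\ge 0\}=\max\{t\in\mathbb Z\mid \operatorname{Ext}^i_R(M,R)_{-t-i}\neq 0\text{ for some } i\ge 0\}.$$
   Context: Let $0\to F_s\to\cdots\to F_1\to F_0\to M\to 0$ be a minimal graded free resolution of $M$ (all maps of degree zero). $b_i(M)$ denotes the maximal degree of the generators of $F_i$, with $b_i(M)=-\infty$ if $F_i=0$. The field $k$ is viewed as the graded module $R/(x_1,\ldots,x_n)$, and $N_t$ denotes the degree-$t$ component of a graded module $N$. The maximum of the empty set is $-\infty$. *)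

theory Defs
  imports
    "HOL-Library.Poly_Mapping"
    "HOL-Library.Function_Algebras"
    "HOL-Library.Extended_Real"
    "HOL-Computational_Algebra.Group_Closure"
    "HOL-Algebra.Coset"
begin

text \<open>The polynomial ring over \<open>'k\<close> in the variables \<open>x :: 'x\<close>, where \<open>'x\<close> is a finite type, so
  \<open>n = CARD('x)\<close>. The ring structure is the convolution product of \<^typ>\<open>('x \<Rightarrow>\<^sub>0 nat) \<Rightarrow>\<^sub>0 'k\<close>.\<close>

type_synonym ('x, 'k) mpoly = "('x \<Rightarrow>\<^sub>0 nat) \<Rightarrow>\<^sub>0 'k"

definition Var :: "'x \<Rightarrow> ('x, 'k::comm_ring_1) mpoly" where
  "Var x = Poly_Mapping.single (Poly_Mapping.single x 1) 1"

definition monom_deg :: "('x::finite \<Rightarrow>\<^sub>0 nat) \<Rightarrow> nat" where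
  "monom_deg m = (\<Sum>x\<in>UNIV. Poly_Mapping.lookup m x)"

definition mpoly_comp :: "int \<Rightarrow> ('x::finite, 'k::comm_ring_1) mpoly set" where
  "mpoly_comp d = {p. \<forall>m\<in>Poly_Mapping.keys p. int (monom_deg m) = d}"

definition irrelevant_ideal :: "('x::finite, 'k::comm_ring_1) mpoly set" where
  "irrelevant_ideal = Modules.module.span (*) (range Var)"


section \<open>Graded modules\<close>

text \<open>A module is a submodule \<open>carr\<close> of a module structure \<open>smult\<close> on a whole type; \<open>comp d\<close> is its
  component of degree \<open>d\<close>.\<close>

record ('r, 'm) grmod =
  smult :: "'r \<Rightarrow> 'm \<Rightarrow> 'm"
  carr :: "'m set"
  comp :: "int \<Rightarrow> 'm set"

definition graded_module ::
    "(('x::finite, 'k::field) mpoly, 'm::ab_group_add) grmod \<Rightarrow> bool" where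
  "graded_module M \<longleftrightarrow>
     Modules.module (smult M) \<and>
     Modules.module.subspace (smult M) (carr M) \<and>
     (\<forall>d. comp M d \<subseteq> carr M \<and> 0 \<in> comp M d \<and>
          (\<forall>u\<in>comp M d. \<forall>v\<in>comp M d. u - v \<in> comp M d)) \<and>
     (\<forall>a b. \<forall>p\<in>mpoly_comp a. \<forall>v\<in>comp M b. smult M p v \<in> comp M (a + b)) \<and>
     (\<forall>v\<in>carr M. \<exists>!f. (\<forall>d. f d \<in> comp M d) \<and> finite {d. f d \<noteq> 0} \<and>
          v = (\<Sum>d | f d \<noteq> 0. f d))"

definition finitely_generated :: "('r::comm_ring_1, 'm::ab_group_add) grmod \<Rightarrow> bool" where
  "finitely_generated M \<longleftrightarrow>
     (\<exists>S. finite S \<and> S \<subseteq> carr M \<and> Modules.module.span (smult M) S = carr M)"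

definition ring_grmod :: "(('x::finite, 'k::field) mpoly, ('x, 'k) mpoly) grmod" where
  "ring_grmod = \<lparr>smult = (*), carr = UNIV, comp = mpoly_comp\<rparr>"

text \<open>The module \<open>R/(x\<^sub>1,\<dots>,x\<^sub>n)\<close>, realised on \<open>k\<close> itself: a polynomial acts through its constant
  coefficient, and everything sits in degree 0. That this is the quotient by the ideal generated
  by the variables is lemma \<open>lookup_0_eq_0_iff\<close> below.\<close>

definition residue_grmod :: "(('x::finite, 'k::field) mpoly, 'k) grmod" where
  "residue_grmod = \<lparr>smult = (\<lambda>p c. Poly_Mapping.lookup p 0 * c), carr = UNIV,
     comp = (\<lambda>d. if d = 0 then UNIV else {0})\<rparr>"

text \<open>\<open>free_grmod ds\<close> is the direct sum of the twists \<open>R(-d)\<close> for \<open>d\<close> in \<open>ds\<close>: its \<open>j\<close>-th basis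
  vector has degree \<open>ds ! j\<close>.\<close>

definition free_grmod :: "int list \<Rightarrow> (('x::finite, 'k::field) mpoly, nat \<Rightarrow> ('x, 'k) mpoly) grmod" where
  "free_grmod ds =
     \<lparr>smult = (\<lambda>p v j. p * v j),
      carr = {v. \<forall>j\<ge>length ds. v j = 0},
      comp = (\<lambda>d. {v. (\<forall>j\<ge>length ds. v j = 0) \<and>
                      (\<forall>j<length ds. v j \<in> mpoly_comp (d - ds ! j))})\<rparr>"

text \<open>Homomorphisms that raise degrees by \<open>d\<close>. Values outside the carrier are fixed to be 0, so
  that equality and addition of functions are those of homomorphisms.\<close>

definition grhom ::
    "('r, 'a::ab_group_add) grmod \<Rightarrow> ('r, 'b::ab_group_add) grmod \<Rightarrow> int \<Rightarrow> ('a \<Rightarrow> 'b) set" where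
  "grhom A B d = {f.
     (\<forall>v. v \<notin> carr A \<longrightarrow> f v = 0) \<and>
     (\<forall>v\<in>carr A. f v \<in> carr B) \<and>
     (\<forall>u\<in>carr A. \<forall>v\<in>carr A. f (u + v) = f u + f v) \<and>
     (\<forall>p. \<forall>v\<in>carr A. f (smult A p v) = smult B p (f v)) \<and>
     (\<forall>e. \<forall>v\<in>comp A e. f v \<in> comp B (e + d))}"


section \<open>Graded free resolutions\<close>

text \<open>\<open>F\<^sub>i = free_grmod (gens P i)\<close>, and \<open>diff P i\<close> is the map \<open>F\<^sub>i\<^sub>+\<^sub>1 \<rightarrow> F\<^sub>i\<close>.\<close>

record ('r, 'm) gfree_complex =
  gens :: "nat \<Rightarrow> int list"
  diff :: "nat \<Rightarrow> (nat \<Rightarrow> 'r) \<Rightarrow> (nat \<Rightarrow> 'r)"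
  aug :: "(nat \<Rightarrow> 'r) \<Rightarrow> 'm"

abbreviation term_of :: "(('x::finite, 'k::field) mpoly, 'm) gfree_complex \<Rightarrow> nat \<Rightarrow>
    (('x, 'k) mpoly, nat \<Rightarrow> ('x, 'k) mpoly) grmod" where
  "term_of P i \<equiv> free_grmod (gens P i)"

definition graded_free_resolution ::
    "(('x::finite, 'k::field) mpoly, 'm::ab_group_add) grmod \<Rightarrow> (('x, 'k) mpoly, 'm) gfree_complex \<Rightarrow> bool" where
  "graded_free_resolution M P \<longleftrightarrow>
     aug P \<in> grhom (term_of P 0) M 0 \<and>
     (\<forall>i. diff P i \<in> grhom (term_of P (Suc i)) (term_of P i) 0) \<and>
     aug P ` carr (term_of P 0) = carr M \<and>
     {v \<in> carr (term_of P 0). aug P v = 0} = diff P 0 ` carr (term_of P 1) \<and>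
     (\<forall>i. {v \<in> carr (term_of P (Suc i)). diff P i v = 0} =
          diff P (Suc i) ` carr (term_of P (Suc (Suc i))))"

definition minimal_graded_free_resolution ::
    "(('x::finite, 'k::field) mpoly, 'm::ab_group_add) grmod \<Rightarrow> (('x, 'k) mpoly, 'm) gfree_complex \<Rightarrow> bool" where
  "minimal_graded_free_resolution M P \<longleftrightarrow>
     graded_free_resolution M P \<and>
     (\<exists>s. \<forall>i>s. gens P i = []) \<and>
     (\<forall>i. diff P i ` carr (term_of P (Suc i)) \<subseteq>
          Modules.module.span (smult (term_of P i))
            {smult (term_of P i) p v | p v. p \<in> irrelevant_ideal \<and> v \<in> carr (term_of P i)})"

definition max_gen_degree :: "('r, 'm) gfree_complex \<Rightarrow> nat \<Rightarrow> ereal" where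
  "max_gen_degree P i =
     (if gens P i = [] then -\<infinity> else ereal (of_int (Max (set (gens P i)))))"

text \<open>The maximum is over a finite set: only finitely many \<open>F\<^sub>i\<close> are nonzero in a minimal
  resolution.\<close>

definition reg :: "('r, 'm) gfree_complex \<Rightarrow> ereal" where
  "reg P = Max {max_gen_degree P i - ereal (real i) | i. True}"


section \<open>Tensor products\<close>

text \<open>\<open>A \<otimes> N\<close> is the free abelian group on \<open>carr A \<times> carr N\<close> modulo the subgroup \<open>tensor_rel A N\<close>.
  Its component of degree \<open>d\<close> consists of the classes of the elements of \<open>tensor_comp A N d\<close>.\<close>

definition tensor_rel :: "('r, 'a::ab_group_add) grmod \<Rightarrow> ('r, 'n::ab_group_add) grmod \<Rightarrow>
    ('a \<times> 'n \<Rightarrow>\<^sub>0 int) set" where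
  "tensor_rel A N = group_closure (
     {frag_of (a + a', n) - frag_of (a, n) - frag_of (a', n) | a a' n.
        a \<in> carr A \<and> a' \<in> carr A \<and> n \<in> carr N} \<union>
     {frag_of (a, n + n') - frag_of (a, n) - frag_of (a, n') | a n n'.
        a \<in> carr A \<and> n \<in> carr N \<and> n' \<in> carr N} \<union>
     {frag_of (smult A p a, n) - frag_of (a, smult N p n) | p a n.
        a \<in> carr A \<and> n \<in> carr N})"

definition tensor_comp :: "('r, 'a::ab_group_add) grmod \<Rightarrow> ('r, 'n::ab_group_add) grmod \<Rightarrow> int \<Rightarrow>
    ('a \<times> 'n \<Rightarrow>\<^sub>0 int) set" where
  "tensor_comp A N d =
     group_closure {frag_of (a, n) | a n. \<exists>i j. i + j = d \<and> a \<in> comp A i \<and> n \<in> comp N j}"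

definition tensor_map :: "('a \<Rightarrow> 'b) \<Rightarrow> ('a \<times> 'n \<Rightarrow>\<^sub>0 int) \<Rightarrow> ('b \<times> 'n \<Rightarrow>\<^sub>0 int)" where
  "tensor_map f = frag_extend (\<lambda>(a, n). frag_of (f a, n))"


section \<open>Tor and Ext\<close>

definition additive_group :: "'a::ab_group_add set \<Rightarrow> 'a monoid" where
  "additive_group Z = \<lparr>carrier = Z, monoid.mult = (+), one = 0\<rparr>"

definition nonzero_group :: "'a monoid \<Rightarrow> bool" where
  "nonzero_group G \<longleftrightarrow> carrier G \<noteq> {\<one>\<^bsub>G\<^esub>}"

definition resolution_of ::
    "(('x::finite, 'k::field) mpoly, 'm::ab_group_add) grmod \<Rightarrow> (('x, 'k) mpoly, 'm) gfree_complex" where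
  "resolution_of M = (SOME P. graded_free_resolution M P)"

text \<open>Cycles and boundaries of degree \<open>d\<close> in \<open>F\<^sub>i \<otimes> N\<close>, given by representatives modulo
  \<open>tensor_rel\<close>.\<close>

definition tor_cycles :: "(('x::finite, 'k::field) mpoly, 'm) gfree_complex \<Rightarrow>
    (('x, 'k) mpoly, 'n::ab_group_add) grmod \<Rightarrow> nat \<Rightarrow> int \<Rightarrow>
    ((nat \<Rightarrow> ('x, 'k) mpoly) \<times> 'n \<Rightarrow>\<^sub>0 int) set" where
  "tor_cycles P N i d = {z \<in> tensor_comp (term_of P i) N d.
     (case i of 0 \<Rightarrow> True
      | Suc j \<Rightarrow> tensor_map (diff P j) z \<in> tensor_rel (term_of P j) N)}"

definition tor_boundaries :: "(('x::finite, 'k::field) mpoly, 'm) gfree_complex \<Rightarrow>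
    (('x, 'k) mpoly, 'n::ab_group_add) grmod \<Rightarrow> nat \<Rightarrow> int \<Rightarrow>
    ((nat \<Rightarrow> ('x, 'k) mpoly) \<times> 'n \<Rightarrow>\<^sub>0 int) set" where
  "tor_boundaries P N i d = {z \<in> tensor_comp (term_of P i) N d.
     \<exists>w\<in>tensor_comp (term_of P (Suc i)) N d.
       z - tensor_map (diff P i) w \<in> tensor_rel (term_of P i) N}"

text \<open>\<open>Tor\<^sub>i(M, N)\<^sub>d\<close>\<close>

definition Tor :: "(('x::finite, 'k::field) mpoly, 'm::ab_group_add) grmod \<Rightarrow>
    (('x, 'k) mpoly, 'n::ab_group_add) grmod \<Rightarrow> nat \<Rightarrow> int \<Rightarrow>
    ((nat \<Rightarrow> ('x, 'k) mpoly) \<times> 'n \<Rightarrow>\<^sub>0 int) set monoid" where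
  "Tor M N i d = additive_group (tor_cycles (resolution_of M) N i d)
     Mod tor_boundaries (resolution_of M) N i d"

definition ext_cocycles :: "(('x::finite, 'k::field) mpoly, 'm) gfree_complex \<Rightarrow>
    (('x, 'k) mpoly, 'n::ab_group_add) grmod \<Rightarrow> nat \<Rightarrow> int \<Rightarrow>
    ((nat \<Rightarrow> ('x, 'k) mpoly) \<Rightarrow> 'n) set" where
  "ext_cocycles P N i d = {f \<in> grhom (term_of P i) N d. f \<circ> diff P i = 0}"

definition ext_coboundaries :: "(('x::finite, 'k::field) mpoly, 'm) gfree_complex \<Rightarrow>
    (('x, 'k) mpoly, 'n::ab_group_add) grmod \<Rightarrow> nat \<Rightarrow> int \<Rightarrow>
    ((nat \<Rightarrow> ('x, 'k) mpoly) \<Rightarrow> 'n) set" where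
  "ext_coboundaries P N i d =
     (case i of 0 \<Rightarrow> {0} | Suc j \<Rightarrow> (\<lambda>g. g \<circ> diff P j) ` grhom (term_of P j) N d)"

text \<open>\<open>Ext\<^sup>i(M, N)\<^sub>d\<close>; the grading is by the degree of homomorphisms, which for finitely generated
  \<open>F\<^sub>i\<close> exhausts \<open>Hom(F\<^sub>i, N)\<close>.\<close>

definition Ext :: "(('x::finite, 'k::field) mpoly, 'm::ab_group_add) grmod \<Rightarrow>
    (('x, 'k) mpoly, 'n::ab_group_add) grmod \<Rightarrow> nat \<Rightarrow> int \<Rightarrow>
    ((nat \<Rightarrow> ('x, 'k) mpoly) \<Rightarrow> 'n) set monoid" where
  "Ext M N i d = additive_group (ext_cocycles (resolution_of M) N i d)
     Mod ext_coboundaries (resolution_of M) N i d"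


section \<open>Maxima of sets of integers\<close>

text \<open>Stated for possibly infinite sets, where \<open>Max\<close> is unspecified: the degrees in which some \<open>Ext\<close>
  module is nonzero are in general unbounded in one direction.\<close>

definition is_max :: "int set \<Rightarrow> ereal \<Rightarrow> bool" where
  "is_max T r \<longleftrightarrow>
     (if T = {} then r = -\<infinity> else \<exists>m\<in>T. (\<forall>t\<in>T. t \<le> m) \<and> r = ereal (of_int m))"


section \<open>The residue field\<close>

lemma module_mult: "Modules.module ((*) :: 'r::comm_ring_1 \<Rightarrow> 'r \<Rightarrow> 'r)"
  by unfold_locales (simp_all add: algebra_simps)

lemma poly_mapping_sum_single:
  "p = (\<Sum>m\<in>Poly_Mapping.keys p. Poly_Mapping.single m (Poly_Mapping.lookup p m))"
proof (rule poly_mapping_eqI)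
  fix k
  have "(\<Sum>m\<in>Poly_Mapping.keys p.
          Poly_Mapping.lookup (Poly_Mapping.single m (Poly_Mapping.lookup p m)) k) =
        (\<Sum>m\<in>Poly_Mapping.keys p. if m = k then Poly_Mapping.lookup p m else 0)"
    by (rule sum.cong) (auto simp: lookup_single when_def)
  then show "Poly_Mapping.lookup p k = Poly_Mapping.lookup
      (\<Sum>m\<in>Poly_Mapping.keys p. Poly_Mapping.single m (Poly_Mapping.lookup p m)) k"
    by (simp add: lookup_sum not_in_keys_iff_lookup_eq_zero sum.delta)
qed

lemma lookup_0_mult_Var:
  fixes p :: "('x::finite, 'k::comm_ring_1) mpoly"
  shows "Poly_Mapping.lookup (p * Var x) 0 = 0"
proof -
  have ne: "m + Poly_Mapping.single x (1::nat) \<noteq> 0" for m :: "'x \<Rightarrow>\<^sub>0 nat"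
  proof
    assume "m + Poly_Mapping.single x 1 = 0"
    then have "Poly_Mapping.lookup (m + Poly_Mapping.single x 1) x = 0" by simp
    then show False by (simp add: lookup_add)
  qed
  have "p * Var x = (\<Sum>m\<in>Poly_Mapping.keys p.
      Poly_Mapping.single m (Poly_Mapping.lookup p m) * Var x)"
    by (subst poly_mapping_sum_single [of p]) (rule sum_distrib_right)
  also have "\<dots> = (\<Sum>m\<in>Poly_Mapping.keys p.
      Poly_Mapping.single (m + Poly_Mapping.single x 1) (Poly_Mapping.lookup p m))"
    by (simp add: Var_def mult_single)
  finally show ?thesis
    by (simp add: lookup_sum lookup_single_not_eq ne del: One_nat_def)
qed

lemma lookup_0_eq_0_iff:
  fixes p :: "('x::finite, 'k::comm_ring_1) mpoly"
  shows "Poly_Mapping.lookup p 0 = 0 \<longleftrightarrow> p \<in> irrelevant_ideal"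
proof
  interpret R: Modules.module "(*) :: ('x, 'k) mpoly \<Rightarrow> _" by (rule module_mult)
  show "Poly_Mapping.lookup p 0 = 0" if "p \<in> irrelevant_ideal"
    using that unfolding irrelevant_ideal_def
    by (induction rule: R.span_induct_alt) (auto simp: lookup_add lookup_0_mult_Var)
  assume p0: "Poly_Mapping.lookup p 0 = 0"
  have "Poly_Mapping.single m (Poly_Mapping.lookup p m) \<in> R.span (range Var)"
    if m: "m \<in> Poly_Mapping.keys p" for m
  proof -
    have "m \<noteq> 0" using m p0 by (auto simp: in_keys_iff)
    then obtain x where x: "Poly_Mapping.lookup m x \<noteq> 0"
      by (metis lookup_zero poly_mapping_eqI)
    define m' where "m' = m - Poly_Mapping.single x 1"
    have "m = m' + Poly_Mapping.single x 1"
      using x by (intro poly_mapping_eqI)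
        (auto simp: m'_def lookup_add lookup_minus lookup_single when_def)
    then have "Poly_Mapping.single m (Poly_Mapping.lookup p m) =
        Poly_Mapping.single m' (Poly_Mapping.lookup p m) * Var x"
      by (simp add: Var_def mult_single)
    then show ?thesis by (simp add: R.span_scale R.span_base)
  qed
  then show "p \<in> irrelevant_ideal"
    unfolding irrelevant_ideal_def by (subst poly_mapping_sum_single) (rule R.span_sum)
qed

end

theory Submission
  imports Defs
begin

text \<open>Any two graded free resolutions of \<open>M\<close> are homotopy equivalent by maps of degree 0, so \<open>Tor\<close> and
  \<open>Ext\<close> can be computed from the minimal resolution \<open>F\<close>. Minimality says that the differentials have
  entries without constant term, so those of \<open>F \<otimes> k\<close> vanish and \<open>Tor\<^sub>i(M, k)\<^sub>d \<noteq> 0\<close> exactly when \<open>d\<close> is the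
  degree of a generator of \<open>F\<^sub>i\<close>. A map \<open>F\<^sub>i \<rightarrow> R\<close> of degree \<open>-t - i\<close> vanishes unless \<open>t \<le> b\<^sub>i - i\<close>, which
  bounds the degrees of \<open>Ext\<close> by the regularity. For the last \<open>i\<close> with \<open>b\<^sub>i - i = reg M\<close>, all generators
  of \<open>F\<^sub>i\<^sub>+\<^sub>1\<close> have degree at most \<open>b\<^sub>i\<close>, and the dual of a generator of \<open>F\<^sub>i\<close> of degree \<open>b\<^sub>i\<close> represents
  a nonzero class in \<open>Ext\<^sup>i(M, R)\<close> of degree \<open>-b\<^sub>i\<close>.\<close>

section \<open>Homogeneous components\<close>

text \<open>The degree is an integer, so that a shift \<open>d - ds ! j\<close> by the degree of a
  generator can be inserted directly; for negative \<open>d\<close> the part is 0.\<close>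

definition hom_part :: "int \<Rightarrow> ('x::finite, 'k::comm_ring_1) mpoly \<Rightarrow> ('x, 'k) mpoly" where
  "hom_part d p = (\<Sum>m | m \<in> Poly_Mapping.keys p \<and> int (monom_deg m) = d.
     Poly_Mapping.single m (Poly_Mapping.lookup p m))"

lemma lookup_hom_part:
  "Poly_Mapping.lookup (hom_part d p) m =
    (if int (monom_deg m) = d then Poly_Mapping.lookup p m else 0)"
proof -
  have "Poly_Mapping.lookup (hom_part d p) m =
      (\<Sum>m' | m' \<in> Poly_Mapping.keys p \<and> int (monom_deg m') = d.
        if m' = m then Poly_Mapping.lookup p m else 0)"
    unfolding hom_part_def lookup_sum by (rule sum.cong) (auto simp: lookup_single when_def)
  also have "\<dots> = (if int (monom_deg m) = d then Poly_Mapping.lookup p m else 0)"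
    by (auto simp: sum.delta in_keys_iff)
  finally show ?thesis .
qed

lemma mpoly_comp_iff:
  "p \<in> mpoly_comp d \<longleftrightarrow> (\<forall>m. Poly_Mapping.lookup p m \<noteq> 0 \<longrightarrow> int (monom_deg m) = d)"
  by (auto simp: mpoly_comp_def in_keys_iff)

lemma hom_part_in_mpoly_comp: "hom_part d p \<in> mpoly_comp d"
  by (auto simp: mpoly_comp_iff lookup_hom_part)

lemma zero_in_mpoly_comp [simp]: "0 \<in> mpoly_comp d"
  by (simp add: mpoly_comp_iff)

lemma diff_in_mpoly_comp: "p \<in> mpoly_comp d \<Longrightarrow> q \<in> mpoly_comp d \<Longrightarrow> p - q \<in> mpoly_comp d"
  unfolding mpoly_comp_iff lookup_minus by (metis diff_zero)

lemma monom_deg_add: "monom_deg (a + b) = monom_deg a + monom_deg b"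
  by (simp add: monom_deg_def lookup_add sum.distrib)

lemma monom_deg_zero [simp]: "monom_deg 0 = 0"
  by (simp add: monom_deg_def)

lemma monom_deg_eq_0_iff: "monom_deg m = 0 \<longleftrightarrow> m = 0"
  by (auto simp: monom_deg_def intro: poly_mapping_eqI)

lemma mult_in_mpoly_comp:
  "p \<in> mpoly_comp a \<Longrightarrow> q \<in> mpoly_comp b \<Longrightarrow> p * q \<in> mpoly_comp (a + b)"
  using keys_mult[of p q] by (fastforce simp: mpoly_comp_def monom_deg_add)

lemma one_in_mpoly_comp: "1 \<in> mpoly_comp 0"
  by (auto simp: mpoly_comp_iff lookup_one when_def)

text \<open>Monomial degrees are natural numbers. This bounds the degrees in which
  \<open>Ext\<close> can be nonzero.\<close>

lemma mpoly_comp_negative: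
  assumes "p \<in> mpoly_comp d" "d < 0"
  shows "p = 0"
  using assms by (intro poly_mapping_eqI) (force simp: mpoly_comp_iff)

lemma lookup_0_mpoly_comp:
  assumes "p \<in> mpoly_comp d" "d \<noteq> 0"
  shows "Poly_Mapping.lookup p 0 = 0"
  using assms by (force simp: mpoly_comp_iff)

lemma mpoly_comp_0_eq_0:
  assumes "p \<in> mpoly_comp 0" "Poly_Mapping.lookup p 0 = 0"
  shows "p = 0"
proof (rule poly_mapping_eqI)
  fix m show "Poly_Mapping.lookup p m = Poly_Mapping.lookup 0 m"
    using assms by (cases "m = 0") (force simp: mpoly_comp_iff monom_deg_eq_0_iff)+
qed

text \<open>Evaluation at the origin is multiplicative: modulo the irrelevant ideal,
  \<open>p\<close> and \<open>q\<close> are congruent to their constant terms, hence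
  \<open>p * q\<close> to the product of these.\<close>

lemma lookup_0_mult:
  fixes p q :: "('x::finite, 'k::comm_ring_1) mpoly"
  shows "Poly_Mapping.lookup (p * q) 0 = Poly_Mapping.lookup p 0 * Poly_Mapping.lookup q 0"
proof -
  interpret R: Modules.module "(*) :: ('x, 'k) mpoly \<Rightarrow> _" by (rule module_mult)
  let ?c = "\<lambda>p. Poly_Mapping.single 0 (Poly_Mapping.lookup p 0) :: ('x, 'k) mpoly"
  have "p - ?c p \<in> irrelevant_ideal" "q - ?c q \<in> irrelevant_ideal"
    by (simp_all add: lookup_minus flip: lookup_0_eq_0_iff)
  then have "q * (p - ?c p) + ?c p * (q - ?c q) \<in> irrelevant_ideal"
    unfolding irrelevant_ideal_def by (intro R.span_add R.span_scale)
  moreover have "q * (p - ?c p) + ?c p * (q - ?c q) = p * q - ?c p * ?c q"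
    by (simp add: algebra_simps)
  ultimately show ?thesis
    by (simp add: lookup_minus mult_single flip: lookup_0_eq_0_iff)
qed

text \<open>The coefficient of the sum at a monomial \<open>m\<close> can only come from the index
  \<open>monom_deg m + c\<close>. The shift \<open>c\<close> accommodates the twist
  \<open>R(-c)\<close>, whose part of degree \<open>d\<close> consists of polynomials of degree
  \<open>d - c\<close>.\<close>

lemma hom_part_unique:
  fixes p :: "('x::finite, 'k::comm_ring_1) mpoly"
  assumes f: "\<And>d. f d \<in> mpoly_comp (d - c)" and S: "finite S" "\<And>d. d \<notin> S \<Longrightarrow> f d = 0"
    and p: "p = (\<Sum>d\<in>S. f d)"
  shows "f d = hom_part (d - c) p"
proof (rule poly_mapping_eqI)
  fix m
  have off: "Poly_Mapping.lookup (f e) m = 0" if "e \<noteq> int (monom_deg m) + c" for e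
    using f[of e] that unfolding mpoly_comp_iff by force
  have "Poly_Mapping.lookup p m = (\<Sum>e\<in>S. if e = int (monom_deg m) + c
      then Poly_Mapping.lookup (f e) m else 0)"
    unfolding p lookup_sum using off by (intro sum.cong) auto
  also have "\<dots> = Poly_Mapping.lookup (f (int (monom_deg m) + c)) m"
    using S by (auto simp: sum.delta')
  finally show "Poly_Mapping.lookup (f d) m = Poly_Mapping.lookup (hom_part (d - c) p) m"
    using off[of d] by (auto simp: lookup_hom_part)
qed

text \<open>The set \<open>S\<close> may be larger than the set of degrees that occur, so one
  \<open>S\<close> can serve all coordinates of a vector in a free module.\<close>

lemma sum_hom_part:
  fixes p :: "('x::finite, 'k::comm_ring_1) mpoly"
  assumes S: "finite S" "\<And>m. m \<in> Poly_Mapping.keys p \<Longrightarrow> int (monom_deg m) + c \<in> S"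
  shows "(\<Sum>d\<in>S. hom_part (d - c) p) = p"
proof (rule poly_mapping_eqI)
  fix m
  have "Poly_Mapping.lookup (\<Sum>d\<in>S. hom_part (d - c) p) m =
      (\<Sum>d\<in>S. if d = int (monom_deg m) + c then Poly_Mapping.lookup p m else 0)"
    unfolding lookup_sum by (rule sum.cong) (auto simp: lookup_hom_part)
  also have "\<dots> = Poly_Mapping.lookup p m"
    using S by (auto simp: sum.delta' in_keys_iff)
  finally show "Poly_Mapping.lookup (\<Sum>d\<in>S. hom_part (d - c) p) m = Poly_Mapping.lookup p m" .
qed


section \<open>Graded modules and their homomorphisms\<close>

lemma graded_moduleD:
  assumes "graded_module M"
  shows graded_module_module: "Modules.module (smult M)"
    and carr_zero: "0 \<in> carr M"
    and carr_add: "u \<in> carr M \<Longrightarrow> v \<in> carr M \<Longrightarrow> u + v \<in> carr M"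
    and carr_smult: "v \<in> carr M \<Longrightarrow> smult M p v \<in> carr M"
    and comp_subset_carr: "v \<in> comp M d \<Longrightarrow> v \<in> carr M"
    and comp_zero: "0 \<in> comp M d"
    and comp_diff: "u \<in> comp M d \<Longrightarrow> v \<in> comp M d \<Longrightarrow> u - v \<in> comp M d"
    and comp_smult: "q \<in> mpoly_comp a \<Longrightarrow> v \<in> comp M b \<Longrightarrow> smult M q v \<in> comp M (a + b)"
    and decomposition_ex1: "v \<in> carr M \<Longrightarrow>
      \<exists>!f. (\<forall>d. f d \<in> comp M d) \<and> finite {d. f d \<noteq> 0} \<and> v = (\<Sum>d | f d \<noteq> 0. f d)"
proof -
  show M: "Modules.module (smult M)" using assms by (simp add: graded_module_def)
  have S: "Modules.module.subspace (smult M) (carr M)" using assms by (simp add: graded_module_def)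
  show "0 \<in> carr M" by (rule Modules.module.subspace_0[OF M S])
  show "u \<in> carr M \<Longrightarrow> v \<in> carr M \<Longrightarrow> u + v \<in> carr M"
    by (rule Modules.module.subspace_add[OF M S])
  show "v \<in> carr M \<Longrightarrow> smult M p v \<in> carr M" by (rule Modules.module.subspace_scale[OF M S])
  have C: "\<forall>d. comp M d \<subseteq> carr M \<and> 0 \<in> comp M d \<and>
      (\<forall>u\<in>comp M d. \<forall>v\<in>comp M d. u - v \<in> comp M d)"
    using assms unfolding graded_module_def by (elim conjE)
  show "v \<in> comp M d \<Longrightarrow> v \<in> carr M" using C by blast
  show "0 \<in> comp M d" using C by blast
  show "u \<in> comp M d \<Longrightarrow> v \<in> comp M d \<Longrightarrow> u - v \<in> comp M d" using C by blast
  have "\<forall>a b. \<forall>p\<in>mpoly_comp a. \<forall>v\<in>comp M b. smult M p v \<in> comp M (a + b)"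
    using assms unfolding graded_module_def by (elim conjE)
  then show "q \<in> mpoly_comp a \<Longrightarrow> v \<in> comp M b \<Longrightarrow> smult M q v \<in> comp M (a + b)" by blast
  show "v \<in> carr M \<Longrightarrow>
      \<exists>!f. (\<forall>d. f d \<in> comp M d) \<and> finite {d. f d \<noteq> 0} \<and> v = (\<Sum>d | f d \<noteq> 0. f d)"
    using assms unfolding graded_module_def by blast
qed

lemma carr_uminus:
  assumes "graded_module M" "v \<in> carr M" shows "- v \<in> carr M"
proof -
  interpret Modules.module "smult M" by (rule graded_module_module[OF assms(1)])
  show ?thesis using carr_smult[OF assms, of "-1"] by simp
qed

lemma carr_diff:
  "graded_module M \<Longrightarrow> u \<in> carr M \<Longrightarrow> v \<in> carr M \<Longrightarrow> u - v \<in> carr M"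
  by (metis carr_add carr_uminus diff_conv_add_uminus)

lemma comp_add:
  "graded_module M \<Longrightarrow> u \<in> comp M d \<Longrightarrow> v \<in> comp M d \<Longrightarrow> u + v \<in> comp M d"
  by (metis comp_diff comp_zero diff_0 diff_minus_eq_add)

lemma carr_sum:
  "graded_module M \<Longrightarrow> (\<And>j. j \<in> J \<Longrightarrow> v j \<in> carr M) \<Longrightarrow> sum v J \<in> carr M"
  by (induction J rule: infinite_finite_induct) (auto simp: carr_zero carr_add)

lemma comp_sum:
  "graded_module M \<Longrightarrow> (\<And>j. j \<in> J \<Longrightarrow> v j \<in> comp M d) \<Longrightarrow> sum v J \<in> comp M d"
  by (induction J rule: infinite_finite_induct) (auto simp: comp_zero comp_add)

text \<open>A homogeneous element is its own decomposition, concentrated in degree \<open>d\<close>;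
  uniqueness of decompositions then forces \<open>u\<close> to agree with it.\<close>

lemma homogeneous_decomposition_unique:
  assumes M: "graded_module M"
    and u: "\<And>e. u e \<in> comp M e" and S: "finite S" "\<And>e. e \<notin> S \<Longrightarrow> u e = 0"
    and b: "b \<in> comp M d" "b = (\<Sum>e\<in>S. u e)"
  shows "u d = b"
proof -
  define Q where "Q f \<longleftrightarrow> (\<forall>e. f e \<in> comp M e) \<and> finite {e. f e \<noteq> 0} \<and>
    b = (\<Sum>e | f e \<noteq> 0. f e)" for f
  have "{e. u e \<noteq> 0} \<subseteq> S" using S by auto
  then have Qu: "Q u" using u S b
    by (auto simp: Q_def finite_subset intro!: sum.mono_neutral_right)
  have Qd: "Q (\<lambda>e. if e = d then b else 0)"
    unfolding Q_def
  proof (intro conjI)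
    show "finite {e. (if e = d then b else 0) \<noteq> 0}" by (rule finite_subset[of _ "{d}"]) auto
    have "{e. (if e = d then b else 0) \<noteq> 0} = (if b = 0 then {} else {d})" by auto
    then show "b = (\<Sum>e | (if e = d then b else 0) \<noteq> 0. if e = d then b else 0)" by auto
  qed (use b comp_zero[OF M] in auto)
  have "\<exists>!f. Q f"
    unfolding Q_def by (rule decomposition_ex1[OF M comp_subset_carr[OF M b(1)]])
  then have "u = (\<lambda>e. if e = d then b else 0)" using Qu Qd by blast
  then show ?thesis by simp
qed

section \<open>Homogeneous homomorphisms, their sums and composites\<close>

lemma grhomD:
  assumes "f \<in> grhom A B d"
  shows grhom_outside: "v \<notin> carr A \<Longrightarrow> f v = 0"
    and grhom_carr: "v \<in> carr A \<Longrightarrow> f v \<in> carr B"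
    and grhom_add: "u \<in> carr A \<Longrightarrow> v \<in> carr A \<Longrightarrow> f (u + v) = f u + f v"
    and grhom_smult: "v \<in> carr A \<Longrightarrow> f (smult A p v) = smult B p (f v)"
    and grhom_comp: "v \<in> comp A e \<Longrightarrow> f v \<in> comp B (e + d)"
  using assms unfolding grhom_def by auto

lemma grhom_zero:
  assumes "graded_module A" "f \<in> grhom A B d" shows "f 0 = 0"
  using grhom_add[OF assms(2) carr_zero carr_zero] assms(1) by simp

lemma grhom_diff:
  assumes A: "graded_module A" and f: "f \<in> grhom A B d" and uv: "u \<in> carr A" "v \<in> carr A"
  shows "f (u - v) = f u - f v"
  using grhom_add[OF f carr_diff[OF A uv] uv(2)] by simp

lemma grhom_sum:
  assumes A: "graded_module A" and f: "f \<in> grhom A B d"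
    and "\<And>j. j \<in> J \<Longrightarrow> v j \<in> carr A"
  shows "f (sum v J) = (\<Sum>j\<in>J. f (v j))"
  using assms(3)
  by (induction J rule: infinite_finite_induct)
    (auto simp: grhom_zero[OF A f] grhom_add[OF f] carr_sum[OF A])

lemma grhom_compose:
  assumes B: "graded_module B" and f: "f \<in> grhom A B d" and g: "g \<in> grhom B C e"
  shows "g \<circ> f \<in> grhom A C (d + e)"
  unfolding grhom_def mem_Collect_eq
proof (intro conjI allI ballI impI)
  fix a v assume "v \<in> comp A a"
  then show "(g \<circ> f) v \<in> comp C (a + (d + e))"
    using grhom_comp[OF g grhom_comp[OF f]] by (simp add: add.assoc)
qed (simp_all add: grhomD[OF f] grhom_zero[OF B g] grhom_carr[OF g] grhom_add[OF g]
  grhom_smult[OF g])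

lemma grhom_plus:
  assumes B: "graded_module B" and f: "f \<in> grhom A B d" and g: "g \<in> grhom A B d"
  shows "f + g \<in> grhom A B d"
proof -
  interpret Modules.module "smult B" by (rule graded_module_module[OF B])
  show ?thesis unfolding grhom_def
    by (auto simp: grhomD[OF f] grhomD[OF g] carr_add[OF B] comp_add[OF B] scale_right_distrib)
qed

lemma grhom_minus:
  assumes B: "graded_module B" and f: "f \<in> grhom A B d" and g: "g \<in> grhom A B d"
  shows "f - g \<in> grhom A B d"
proof -
  interpret Modules.module "smult B" by (rule graded_module_module[OF B])
  show ?thesis unfolding grhom_def
    by (auto simp: grhomD[OF f] grhomD[OF g] carr_diff[OF B] comp_diff[OF B]
      scale_right_diff_distrib)
qed

lemma grhom_0:
  assumes B: "graded_module B" shows "0 \<in> grhom A B d"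
proof -
  interpret Modules.module "smult B" by (rule graded_module_module[OF B])
  show ?thesis unfolding grhom_def by (auto simp: carr_zero[OF B] comp_zero[OF B])
qed

text \<open>The identity of \<open>A\<close> as an element of \<open>grhom A A 0\<close>, where
  values outside the carrier have to be 0.\<close>

definition grid :: "('r, 'a::ab_group_add) grmod \<Rightarrow> 'a \<Rightarrow> 'a" where
  "grid A = (\<lambda>v. if v \<in> carr A then v else 0)"

lemma grid_in_grhom: "graded_module A \<Longrightarrow> grid A \<in> grhom A A 0"
  by (auto simp: grhom_def grid_def carr_add carr_smult comp_subset_carr)

text \<open>A map of degree 0 sends the homogeneous components of \<open>a\<close> to those of
  \<open>g a\<close>, so the component of \<open>a\<close> in degree \<open>d\<close> is already a
  preimage. This is what makes liftings homogeneous.\<close>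

lemma homogeneous_preimage:
  assumes A: "graded_module A" and B: "graded_module B" and g: "g \<in> grhom A B 0"
    and a: "a \<in> carr A" "g a \<in> comp B d"
  shows "\<exists>a'\<in>comp A d. g a' = g a"
proof -
  obtain f where f: "\<And>e. f e \<in> comp A e" "finite {e. f e \<noteq> 0}" "a = (\<Sum>e | f e \<noteq> 0. f e)"
    using decomposition_ex1[OF A a(1)] by blast
  have "g (f d) = g a"
  proof (rule homogeneous_decomposition_unique[OF B _ f(2) _ a(2)])
    show "g (f e) \<in> comp B e" for e using grhom_comp[OF g f(1)[of e]] by simp
    show "g (f e) = 0" if "e \<notin> {e. f e \<noteq> 0}" for e
      using that by (simp add: grhom_zero[OF A g])
    show "g a = (\<Sum>e | f e \<noteq> 0. g (f e))"
      unfolding f(3) by (rule grhom_sum[OF A g]) (auto intro: comp_subset_carr[OF A f(1)])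
  qed
  with f(1) show ?thesis by blast
qed

section \<open>The polynomial ring as a graded module over itself\<close>

lemma graded_module_ring_grmod:
  "graded_module (ring_grmod :: (('x::finite, 'k::field) mpoly, ('x, 'k) mpoly) grmod)"
proof -
  interpret R: Modules.module "(*) :: ('x, 'k) mpoly \<Rightarrow> _" by (rule module_mult)
  show ?thesis
    unfolding graded_module_def
  proof (intro conjI allI ballI)
    fix p :: "('x, 'k) mpoly"
    let ?Q = "\<lambda>f. (\<forall>d. f d \<in> comp ring_grmod d) \<and> finite {d. f d \<noteq> 0} \<and>
      p = (\<Sum>d | f d \<noteq> 0. f d)"
    let ?S = "(\<lambda>m. int (monom_deg m)) ` Poly_Mapping.keys p"
    have S: "{d. hom_part d p \<noteq> 0} \<subseteq> ?S"
    proof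
      fix d assume "d \<in> {d. hom_part d p \<noteq> 0}"
      then have "hom_part d p \<noteq> 0" by simp
      then obtain m where "Poly_Mapping.lookup (hom_part d p) m \<noteq> 0"
        by (metis lookup_zero poly_mapping_eqI)
      then show "d \<in> ?S" by (auto simp: lookup_hom_part in_keys_iff split: if_splits)
    qed
    show "\<exists>!f. ?Q f"
    proof (rule ex1I[of _ "\<lambda>d. hom_part d p"])
      have "p = (\<Sum>d\<in>?S. hom_part d p)" using sum_hom_part[of ?S p 0] by simp
      also have "\<dots> = (\<Sum>d | hom_part d p \<noteq> 0. hom_part d p)"
        by (rule sum.mono_neutral_right) (use S in auto)
      finally have "p = (\<Sum>d | hom_part d p \<noteq> 0. hom_part d p)" .
      then show "?Q (\<lambda>d. hom_part d p)"
        using finite_subset[OF S]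
        by (intro conjI allI) (simp_all add: ring_grmod_def hom_part_in_mpoly_comp)
      fix f assume f: "?Q f"
      show "f = (\<lambda>d. hom_part d p)"
      proof
        fix d
        have "f d = hom_part (d - 0) p"
          by (rule hom_part_unique[where S = "{d. f d \<noteq> 0}"])
            (use f in \<open>simp_all add: ring_grmod_def\<close>)
        then show "f d = hom_part d p" by simp
      qed
    qed
  qed (auto simp: ring_grmod_def R.module_axioms diff_in_mpoly_comp mult_in_mpoly_comp)
qed


section \<open>Graded free modules\<close>

definition basis_vec :: "nat \<Rightarrow> nat \<Rightarrow> ('x, 'k::comm_ring_1) mpoly" where
  "basis_vec j = (\<lambda>l. if l = j then 1 else 0)"

lemma module_free: "Modules.module (smult (free_grmod ds))"
  by unfold_locales (auto simp: free_grmod_def fun_eq_iff algebra_simps)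

lemma sum_fun_apply: "(\<Sum>x\<in>A. f x) y = (\<Sum>x\<in>A. f x y)"
  by (induction A rule: infinite_finite_induct) auto

lemma graded_module_free:
  "graded_module (free_grmod ds :: (('x::finite, 'k::field) mpoly, nat \<Rightarrow> ('x, 'k) mpoly) grmod)"
  unfolding graded_module_def
proof (intro conjI allI ballI)
  show "Modules.module.subspace (smult (free_grmod ds)) (carr (free_grmod ds))"
    unfolding Modules.module.subspace_def[OF module_free] by (auto simp: free_grmod_def)
next
  fix a b :: int and p :: "('x, 'k) mpoly" and v :: "nat \<Rightarrow> ('x, 'k) mpoly"
  assume "p \<in> mpoly_comp a" "v \<in> comp (free_grmod ds) b"
  then show "smult (free_grmod ds) p v \<in> comp (free_grmod ds) (a + b)"
    using mult_in_mpoly_comp[of p a] by (fastforce simp: free_grmod_def add_diff_eq[symmetric])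
next
  fix v :: "nat \<Rightarrow> ('x, 'k) mpoly" assume v: "v \<in> carr (free_grmod ds)"
  let ?Q = "\<lambda>f. (\<forall>d. f d \<in> comp (free_grmod ds) d) \<and> finite {d. f d \<noteq> 0} \<and>
      v = (\<Sum>d | f d \<noteq> 0. f d)"
  \<comment> \<open>In the twist \<open>R(-e)\<close> with \<open>e = ds ! j\<close>, degree
    \<open>d\<close> means polynomials of degree \<open>d - e\<close>, so the decomposition is taken
    coordinatewise with this shift.\<close>
  define h where "h = (\<lambda>d j. if j < length ds then hom_part (d - ds ! j) (v j) else 0)"
  let ?S = "\<Union>j<length ds. (\<lambda>m. int (monom_deg m) + ds ! j) ` Poly_Mapping.keys (v j)"
  have fin: "finite ?S" by auto
  have S: "{d. h d \<noteq> 0} \<subseteq> ?S"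
  proof
    fix d assume "d \<in> {d. h d \<noteq> 0}"
    then obtain j where "h d j \<noteq> 0" by (auto simp: fun_eq_iff)
    then have "j < length ds" "hom_part (d - ds ! j) (v j) \<noteq> 0"
      by (auto simp: h_def split: if_splits)
    moreover then obtain m where "Poly_Mapping.lookup (hom_part (d - ds ! j) (v j)) m \<noteq> 0"
      by (metis lookup_zero poly_mapping_eqI)
    ultimately show "d \<in> ?S"
      by (auto simp: lookup_hom_part in_keys_iff split: if_splits intro!: bexI[of _ j] image_eqI[of _ _ m])
  qed
  show "\<exists>!f. ?Q f"
  proof (rule ex1I[of _ h])
    have "v = (\<Sum>d\<in>?S. h d)"
    proof
      fix j show "v j = (\<Sum>d\<in>?S. h d) j"
      proof (cases "j < length ds")
        case True
        then have "(\<Sum>d\<in>?S. hom_part (d - ds ! j) (v j)) = v j"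
          by (intro sum_hom_part fin) auto
        then show ?thesis using True by (simp add: sum_fun_apply h_def)
      next
        case False
        then show ?thesis using v by (simp add: sum_fun_apply h_def free_grmod_def)
      qed
    qed
    also have "\<dots> = (\<Sum>d | h d \<noteq> 0. h d)"
      by (rule sum.mono_neutral_right[OF fin S]) auto
    finally show "?Q h" using finite_subset[OF S fin]
      by (auto simp: free_grmod_def h_def hom_part_in_mpoly_comp)
    fix f assume f: "?Q f"
    show "f = h"
    proof (intro ext)
      fix d j
      show "f d j = h d j"
      proof (cases "j < length ds")
        case True
        have "f d j = hom_part (d - ds ! j) (v j)"
        proof (rule hom_part_unique[where f = "\<lambda>d. f d j" and S = "{d. f d \<noteq> 0}"])
          show "v j = (\<Sum>d | f d \<noteq> 0. f d j)" using f by (metis sum_fun_apply)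
        qed (use f True in \<open>auto simp: free_grmod_def\<close>)
        then show ?thesis using True by (simp add: h_def)
      next
        case False
        then show ?thesis using f by (auto simp: free_grmod_def h_def)
      qed
    qed
  qed
next
  fix u v :: "nat \<Rightarrow> ('x, 'k) mpoly" and d
  assume "u \<in> comp (free_grmod ds) d" "v \<in> comp (free_grmod ds) d"
  then show "u - v \<in> comp (free_grmod ds) d" by (simp add: free_grmod_def diff_in_mpoly_comp)
qed (simp_all add: module_free, auto simp: free_grmod_def)

lemma basis_vec_comp: "j < length ds \<Longrightarrow> basis_vec j \<in> comp (free_grmod ds) (ds ! j)"
  by (auto simp: free_grmod_def basis_vec_def one_in_mpoly_comp)

lemmas basis_vec_carr = comp_subset_carr[OF graded_module_free basis_vec_comp]

lemma free_expansion:
  assumes "v \<in> carr (free_grmod ds)"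
  shows "v = (\<Sum>j<length ds. smult (free_grmod ds) (v j) (basis_vec j))"
proof
  fix l
  have "(\<Sum>j<length ds. v j * (if l = j then 1 else 0)) = (\<Sum>j<length ds. if l = j then v l else 0)"
    by (rule sum.cong) auto
  also have "\<dots> = v l" using assms by (auto simp: free_grmod_def not_less)
  finally show "v l = (\<Sum>j<length ds. smult (free_grmod ds) (v j) (basis_vec j)) l"
    by (simp add: sum_fun_apply free_grmod_def basis_vec_def)
qed

lemma grhom_free_expansion:
  assumes f: "f \<in> grhom (free_grmod ds) B d" and v: "v \<in> carr (free_grmod ds)"
  shows "f v = (\<Sum>j<length ds. smult B (v j) (f (basis_vec j)))"
proof -
  have "f v = f (\<Sum>j<length ds. smult (free_grmod ds) (v j) (basis_vec j))"
    using free_expansion[OF v] by simp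
  also have "\<dots> = (\<Sum>j<length ds. smult B (v j) (f (basis_vec j)))"
    by (subst grhom_sum[OF graded_module_free f])
      (auto simp: grhom_smult[OF f] basis_vec_carr carr_smult[OF graded_module_free])
  finally show ?thesis .
qed

text \<open>The formula for \<open>h\<close> is linear in the coordinates of \<open>v\<close>; it is
  homogeneous because for \<open>v\<close> of degree \<open>e\<close> the degrees of
  \<open>v j\<close> and \<open>a j\<close> add up to \<open>e + d\<close>.\<close>

lemma free_grhom_exists:
  fixes A :: "(('x::finite, 'k::field) mpoly, 'm::ab_group_add) grmod"
  assumes A: "graded_module A" and a: "\<And>j. j < length ds \<Longrightarrow> a j \<in> comp A (ds ! j + d)"
  obtains h where "h \<in> grhom (free_grmod ds) A d"
    "\<And>v. v \<in> carr (free_grmod ds) \<Longrightarrow> h v = (\<Sum>j<length ds. smult A (v j) (a j))"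
proof -
  interpret A: Modules.module "smult A" by (rule graded_module_module[OF A])
  define h where "h = (\<lambda>v. if v \<in> carr (free_grmod ds) then
    (\<Sum>j<length ds. smult A (v j) (a j)) else 0)"
  have ac: "a j \<in> carr A" if "j < length ds" for j using comp_subset_carr[OF A a[OF that]] .
  have "h \<in> grhom (free_grmod ds) A d"
    unfolding grhom_def mem_Collect_eq
  proof (intro conjI allI ballI impI)
    fix v :: "nat \<Rightarrow> ('x, 'k) mpoly" assume "v \<in> carr (free_grmod ds)"
    then show "h v \<in> carr A" by (auto simp: h_def ac carr_smult[OF A] intro!: carr_sum[OF A])
  next
    fix u v :: "nat \<Rightarrow> ('x, 'k) mpoly" assume "u \<in> carr (free_grmod ds)" "v \<in> carr (free_grmod ds)"
    then show "h (u + v) = h u + h v"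
      using carr_add[OF graded_module_free, of u ds v]
      by (simp add: h_def A.scale_left_distrib sum.distrib)
  next
    fix p :: "('x, 'k) mpoly" and v :: "nat \<Rightarrow> ('x, 'k) mpoly"
    assume "v \<in> carr (free_grmod ds)"
    then show "h (smult (free_grmod ds) p v) = smult A p (h v)"
      using carr_smult[OF graded_module_free, of v ds p]
      by (simp add: h_def A.scale_sum_right) (simp add: free_grmod_def)
  next
    fix e and v :: "nat \<Rightarrow> ('x, 'k) mpoly" assume v: "v \<in> comp (free_grmod ds) e"
    have "smult A (v j) (a j) \<in> comp A (e + d)" if "j < length ds" for j
      using comp_smult[OF A _ a[OF that], of "v j" "e - ds ! j"] v that
      by (simp add: free_grmod_def add.assoc[symmetric])
    then show "h v \<in> comp A (e + d)"
      using comp_subset_carr[OF graded_module_free v] by (auto simp: h_def intro!: comp_sum[OF A])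
  qed (simp add: h_def)
  then show ?thesis by (rule that) (simp add: h_def)
qed

text \<open>Projectivity of graded free modules: the basis vectors are lifted one by one through
  \<open>homogeneous_preimage\<close>, and the choice extends linearly. An inclusion of images, in
  place of surjectivity of \<open>g\<close>, is the form in which exactness supplies the
  hypothesis.\<close>

lemma free_lift:
  assumes A: "graded_module A" and B: "graded_module B"
    and f: "f \<in> grhom (free_grmod ds) B 0" and g: "g \<in> grhom A B 0"
    and im: "f ` carr (free_grmod ds) \<subseteq> g ` carr A"
  shows "\<exists>h\<in>grhom (free_grmod ds) A 0. \<forall>v\<in>carr (free_grmod ds). g (h v) = f v"
proof -
  have "\<exists>a\<in>comp A (ds ! j). g a = f (basis_vec j)" if j: "j < length ds" for j
  proof -
    obtain a where "a \<in> carr A" "g a = f (basis_vec j)"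
      using im basis_vec_carr[OF j] by (metis image_iff image_subset_iff)
    then show ?thesis
      using homogeneous_preimage[OF A B g, of a "ds ! j"] grhom_comp[OF f basis_vec_comp[OF j]]
      by auto
  qed
  then obtain a where a: "\<And>j. j < length ds \<Longrightarrow> a j \<in> comp A (ds ! j)"
    "\<And>j. j < length ds \<Longrightarrow> g (a j) = f (basis_vec j)" by metis
  then obtain h where h: "h \<in> grhom (free_grmod ds) A 0"
    "\<And>v. v \<in> carr (free_grmod ds) \<Longrightarrow> h v = (\<Sum>j<length ds. smult A (v j) (a j))"
    using free_grhom_exists[OF A, of ds a 0] by auto
  have ac: "a j \<in> carr A" if "j < length ds" for j using comp_subset_carr[OF A a(1)[OF that]] .
  have "g (h v) = f v" if v: "v \<in> carr (free_grmod ds)" for v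
    unfolding h(2)[OF v] grhom_free_expansion[OF f v]
    by (subst grhom_sum[OF A g]) (auto simp: ac carr_smult[OF A] grhom_smult[OF g] a(2))
  with h(1) show ?thesis by blast
qed


section \<open>Comparison of graded free resolutions\<close>

lemma graded_free_resolutionD:
  assumes "graded_free_resolution M P"
  shows aug_grhom: "aug P \<in> grhom (term_of P 0) M 0"
    and diff_grhom: "diff P i \<in> grhom (term_of P (Suc i)) (term_of P i) 0"
    and aug_surj: "aug P ` carr (term_of P 0) = carr M"
    and exact_aug: "v \<in> carr (term_of P 0) \<Longrightarrow> aug P v = 0 \<longleftrightarrow> v \<in> diff P 0 ` carr (term_of P (Suc 0))"
    and exact_diff: "v \<in> carr (term_of P (Suc i)) \<Longrightarrow>
      diff P i v = 0 \<longleftrightarrow> v \<in> diff P (Suc i) ` carr (term_of P (Suc (Suc i)))"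
  using assms unfolding graded_free_resolution_def set_eq_iff by force+

lemma diff_diff_eq_0:
  assumes P: "graded_free_resolution M P" and v: "v \<in> carr (term_of P (Suc (Suc i)))"
  shows "diff P i (diff P (Suc i) v) = 0"
  using exact_diff[OF P grhom_carr[OF diff_grhom[OF P] v]] v by blast

lemma aug_diff_eq_0:
  assumes P: "graded_free_resolution M P" and v: "v \<in> carr (term_of P (Suc 0))"
  shows "aug P (diff P 0 v) = 0"
  using exact_aug[OF P grhom_carr[OF diff_grhom[OF P] v]] v by blast

text \<open>A lift of the identity of the resolved module to maps of degree 0 between the
  resolutions.\<close>

definition chain_map where
  "chain_map Q P \<phi> \<longleftrightarrow> (\<forall>i. \<phi> i \<in> grhom (term_of Q i) (term_of P i) 0) \<and>
     (\<forall>v\<in>carr (term_of Q 0). aug P (\<phi> 0 v) = aug Q v) \<and>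
     (\<forall>i. \<forall>v\<in>carr (term_of Q (Suc i)). diff P i (\<phi> (Suc i) v) = \<phi> i (diff Q i v))"

lemma chain_mapD:
  assumes "chain_map Q P \<phi>"
  shows chain_map_grhom: "\<phi> i \<in> grhom (term_of Q i) (term_of P i) 0"
    and chain_map_aug: "v \<in> carr (term_of Q 0) \<Longrightarrow> aug P (\<phi> 0 v) = aug Q v"
    and chain_map_diff:
      "v \<in> carr (term_of Q (Suc i)) \<Longrightarrow> diff P i (\<phi> (Suc i) v) = \<phi> i (diff Q i v)"
  using assms unfolding chain_map_def by auto

text \<open>The comparison theorem: the terms of \<open>Q\<close> are free and \<open>P\<close> is
  exact, so the identity of \<open>M\<close> lifts step by step.\<close>

lemma chain_map_exists:
  assumes M: "graded_module M"
    and Q: "graded_free_resolution M Q" and P: "graded_free_resolution M P"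
  shows "\<exists>\<phi>. chain_map Q P \<phi>"
proof -
  \<comment> \<open>Besides commutation with the augmentations at index 0, the invariant records
    that \<open>f\<close> carries boundaries of \<open>Q\<close> to boundaries of \<open>P\<close>;
    this is the hypothesis of \<open>free_lift\<close> for the next map.\<close>
  let ?A = "\<lambda>n f. f \<in> grhom (term_of Q n) (term_of P n) 0 \<and>
    (\<forall>v\<in>carr (term_of Q (Suc n)). f (diff Q n v) \<in> diff P n ` carr (term_of P (Suc n))) \<and>
    (n = 0 \<longrightarrow> (\<forall>v\<in>carr (term_of Q 0). aug P (f v) = aug Q v))"
  let ?B = "\<lambda>n f g. \<forall>v\<in>carr (term_of Q (Suc n)). diff P n (g v) = f (diff Q n v)"
  have "\<exists>\<phi>. \<forall>n. ?A n (\<phi> n) \<and> ?B n (\<phi> n) (\<phi> (Suc n))"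
  proof (rule dependent_nat_choice)
    have "aug Q ` carr (term_of Q 0) \<subseteq> aug P ` carr (term_of P 0)"
      by (simp add: aug_surj[OF P] aug_surj[OF Q])
    from free_lift[OF graded_module_free M aug_grhom[OF Q] aug_grhom[OF P] this]
    obtain f where f: "f \<in> grhom (term_of Q 0) (term_of P 0) 0"
      "\<And>v. v \<in> carr (term_of Q 0) \<Longrightarrow> aug P (f v) = aug Q v" by blast
    have "f (diff Q 0 v) \<in> diff P 0 ` carr (term_of P (Suc 0))"
      if v: "v \<in> carr (term_of Q (Suc 0))" for v
      using exact_aug[OF P grhom_carr[OF f(1)]] f(2) aug_diff_eq_0[OF Q v]
        grhom_carr[OF diff_grhom[OF Q] v] by auto
    with f show "\<exists>f. ?A 0 f" by blast
  next
    fix f n assume A: "?A n f"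
    then have f: "f \<in> grhom (term_of Q n) (term_of P n) 0" by blast
    note d = diff_grhom[OF Q, of n]
    have fd: "f \<circ> diff Q n \<in> grhom (term_of Q (Suc n)) (term_of P n) 0"
      using grhom_compose[OF graded_module_free d f] by simp
    have "(f \<circ> diff Q n) ` carr (term_of Q (Suc n)) \<subseteq> diff P n ` carr (term_of P (Suc n))"
      using A by auto
    from free_lift[OF graded_module_free graded_module_free fd diff_grhom[OF P] this]
    obtain g where g: "g \<in> grhom (term_of Q (Suc n)) (term_of P (Suc n)) 0"
      "\<And>v. v \<in> carr (term_of Q (Suc n)) \<Longrightarrow> diff P n (g v) = f (diff Q n v)" by auto
    \<comment> \<open>\<open>diff P n\<close> sends this element to
      \<open>f (diff Q n (diff Q (Suc n) v))\<close>, which is 0; exactness of \<open>P\<close> does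
      the rest.\<close>
    have "g (diff Q (Suc n) v) \<in> diff P (Suc n) ` carr (term_of P (Suc (Suc n)))"
      if v: "v \<in> carr (term_of Q (Suc (Suc n)))" for v
    proof -
      have "diff Q (Suc n) v \<in> carr (term_of Q (Suc n))" using grhom_carr[OF diff_grhom[OF Q] v] .
      then show ?thesis
        using exact_diff[OF P grhom_carr[OF g(1)], of "diff Q (Suc n) v"] g(2)
          diff_diff_eq_0[OF Q v] grhom_zero[OF graded_module_free f] by simp
    qed
    with g show "\<exists>g. ?A (Suc n) g \<and> ?B n f g" by blast
  qed
  then obtain \<phi> where "\<And>n. ?A n (\<phi> n) \<and> ?B n (\<phi> n) (\<phi> (Suc n))" by blast
  then show ?thesis unfolding chain_map_def by (intro exI[of _ \<phi>]) blast
qed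

lemma chain_map_compose:
  assumes f: "chain_map Q P \<phi>" and g: "chain_map P S \<psi>"
  shows "chain_map Q S (\<lambda>i. \<psi> i \<circ> \<phi> i)"
  unfolding chain_map_def
proof (intro conjI allI ballI)
  show "\<psi> i \<circ> \<phi> i \<in> grhom (term_of Q i) (term_of S i) 0" for i
    using grhom_compose[OF graded_module_free chain_map_grhom[OF f] chain_map_grhom[OF g]] by simp
qed (simp_all add: chain_map_aug[OF f] chain_map_aug[OF g] chain_map_diff[OF f] chain_map_diff[OF g]
  grhom_carr[OF chain_map_grhom[OF f]])

text \<open>A chain homotopy between the identity and \<open>\<theta>\<close>. The lowest index is
  separate, since there is no term below \<open>term_of Q 0\<close>.\<close>

definition homotopy_to_id where
  "homotopy_to_id Q \<theta> h \<longleftrightarrow> (\<forall>i. h i \<in> grhom (term_of Q i) (term_of Q (Suc i)) 0) \<and>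
     (\<forall>v\<in>carr (term_of Q 0). diff Q 0 (h 0 v) = v - \<theta> 0 v) \<and>
     (\<forall>i. \<forall>v\<in>carr (term_of Q (Suc i)).
        diff Q (Suc i) (h (Suc i) v) + h i (diff Q i v) = v - \<theta> (Suc i) v)"

text \<open>Both the identity and \<open>\<theta>\<close> lift the identity of \<open>M\<close>, so
  their difference is null-homotopic. The recursion follows \<open>chain_map_exists\<close>, with
  the invariant that the remaining error is a boundary.\<close>

lemma homotopy_to_id_exists:
  assumes M: "graded_module M"
    and Q: "graded_free_resolution M Q" and \<theta>: "chain_map Q Q \<theta>"
  shows "\<exists>h. homotopy_to_id Q \<theta> h"
proof -
  let ?A = "\<lambda>n f. f \<in> grhom (term_of Q n) (term_of Q (Suc n)) 0 \<and>
    (\<forall>v\<in>carr (term_of Q (Suc n)). v - \<theta> (Suc n) v - f (diff Q n v) \<in>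
        diff Q (Suc n) ` carr (term_of Q (Suc (Suc n)))) \<and>
    (n = 0 \<longrightarrow> (\<forall>v\<in>carr (term_of Q 0). diff Q 0 (f v) = v - \<theta> 0 v))"
  let ?B = "\<lambda>n f g. \<forall>v\<in>carr (term_of Q (Suc n)).
    diff Q (Suc n) (g v) = v - \<theta> (Suc n) v - f (diff Q n v)"
  note d = diff_grhom[OF Q] and t = chain_map_grhom[OF \<theta>] and fm = graded_module_free
  note dc = grhom_carr[OF d] and tc = grhom_carr[OF t]
  have "\<exists>\<phi>. \<forall>n. ?A n (\<phi> n) \<and> ?B n (\<phi> n) (\<phi> (Suc n))"
  proof (rule dependent_nat_choice)
    let ?u = "grid (term_of Q 0) - \<theta> 0"
    have u: "?u \<in> grhom (term_of Q 0) (term_of Q 0) 0"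
      by (intro grhom_minus fm grid_in_grhom t)
    \<comment> \<open>\<open>\<theta>\<close> commutes with the augmentation, so the difference lies
      in its kernel, which consists of boundaries.\<close>
    have "v - \<theta> 0 v \<in> diff Q 0 ` carr (term_of Q (Suc 0))" if v: "v \<in> carr (term_of Q 0)" for v
      using exact_aug[OF Q carr_diff[OF fm v tc[OF v]]]
      by (simp add: grhom_diff[OF fm aug_grhom[OF Q] v tc[OF v]] chain_map_aug[OF \<theta> v])
    then have "?u ` carr (term_of Q 0) \<subseteq> diff Q 0 ` carr (term_of Q (Suc 0))"
      by (auto simp: grid_def)
    from free_lift[OF fm fm u d this]
    obtain f where f: "f \<in> grhom (term_of Q 0) (term_of Q (Suc 0)) 0"
      "\<And>v. v \<in> carr (term_of Q 0) \<Longrightarrow> diff Q 0 (f v) = v - \<theta> 0 v" by (auto simp: grid_def)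
    have "v - \<theta> (Suc 0) v - f (diff Q 0 v) \<in> diff Q (Suc 0) ` carr (term_of Q (Suc (Suc 0)))"
      if v: "v \<in> carr (term_of Q (Suc 0))" for v
    proof -
      note c1 = carr_diff[OF fm v tc[OF v]] and c2 = grhom_carr[OF f(1) dc[OF v]]
      show ?thesis
        using exact_diff[OF Q carr_diff[OF fm c1 c2]]
        by (simp add: grhom_diff[OF fm d c1 c2] grhom_diff[OF fm d v tc[OF v]] f(2)[OF dc[OF v]]
          chain_map_diff[OF \<theta> v])
    qed
    with f show "\<exists>f. ?A 0 f" by blast
  next
    fix f n assume A: "?A n f"
    then have f: "f \<in> grhom (term_of Q n) (term_of Q (Suc n)) 0" by blast
    let ?u = "grid (term_of Q (Suc n)) - \<theta> (Suc n) - (f \<circ> diff Q n)"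
    have "f \<circ> diff Q n \<in> grhom (term_of Q (Suc n)) (term_of Q (Suc n)) 0"
      using grhom_compose[OF fm d f] by simp
    then have u: "?u \<in> grhom (term_of Q (Suc n)) (term_of Q (Suc n)) 0"
      by (intro grhom_minus fm grid_in_grhom t)
    have "?u ` carr (term_of Q (Suc n)) \<subseteq> diff Q (Suc n) ` carr (term_of Q (Suc (Suc n)))"
      using A by (auto simp: grid_def)
    from free_lift[OF fm fm u d this]
    obtain g where g: "g \<in> grhom (term_of Q (Suc n)) (term_of Q (Suc (Suc n))) 0"
      "\<And>v. v \<in> carr (term_of Q (Suc n)) \<Longrightarrow>
        diff Q (Suc n) (g v) = v - \<theta> (Suc n) v - f (diff Q n v)" by (auto simp: grid_def)
    \<comment> \<open>The error is a cycle: by the defining equation of \<open>g\<close>, its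
      differential is \<open>f (diff Q n (diff Q (Suc n) v))\<close>, hence 0.\<close>
    have "v - \<theta> (Suc (Suc n)) v - g (diff Q (Suc n) v) \<in>
        diff Q (Suc (Suc n)) ` carr (term_of Q (Suc (Suc (Suc n))))"
      if v: "v \<in> carr (term_of Q (Suc (Suc n)))" for v
    proof -
      note c1 = carr_diff[OF fm v tc[OF v]] and c2 = grhom_carr[OF g(1) dc[OF v]]
      show ?thesis
        using exact_diff[OF Q carr_diff[OF fm c1 c2]]
        by (simp add: grhom_diff[OF fm d c1 c2] grhom_diff[OF fm d v tc[OF v]] g(2)[OF dc[OF v]]
          chain_map_diff[OF \<theta> v] diff_diff_eq_0[OF Q v] grhom_zero[OF fm f])
    qed
    with g show "\<exists>g. ?A (Suc n) g \<and> ?B n f g" by blast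
  qed
  then obtain h where "\<And>n. ?A n (h n) \<and> ?B n (h n) (h (Suc n))" by blast
  then show ?thesis unfolding homotopy_to_id_def
    by (intro exI[of _ h] conjI) (blast, blast, simp add: diff_eq_eq)
qed

text \<open>The homotopy on the side of \<open>Q\<close> carries vanishing from \<open>P\<close> to
  \<open>Q\<close>; exchanging \<open>P\<close> and \<open>Q\<close> gives the converse.\<close>

lemma homotopy_equivalence:
  assumes M: "graded_module M"
    and Q: "graded_free_resolution M Q" and P: "graded_free_resolution M P"
  obtains \<phi> \<psi> h where "chain_map Q P \<phi>" "chain_map P Q \<psi>"
    "homotopy_to_id Q (\<lambda>i. \<psi> i \<circ> \<phi> i) h"
proof -
  obtain \<phi> where \<phi>: "chain_map Q P \<phi>" using chain_map_exists[OF M Q P] by blast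
  obtain \<psi> where \<psi>: "chain_map P Q \<psi>" using chain_map_exists[OF M P Q] by blast
  obtain h where "homotopy_to_id Q (\<lambda>i. \<psi> i \<circ> \<phi> i) h"
    using homotopy_to_id_exists[OF M Q chain_map_compose[OF \<phi> \<psi>]] by blast
  with \<phi> \<psi> show ?thesis by (rule that)
qed


section \<open>Independence of Ext from the resolution\<close>

text \<open>A cocycle \<open>f\<close> on \<open>Q\<close> is pulled back along \<psi> to
  \<open>P\<close>, where it becomes a coboundary; pulling back again along \<phi> recovers
  \<open>f\<close> up to a correction by the homotopy.\<close>

lemma ext_cocycles_coboundaries_transfer:
  assumes M: "graded_module M" and N: "graded_module N"
    and Q: "graded_free_resolution M Q" and P: "graded_free_resolution M P"
    and van: "ext_cocycles P N i d \<subseteq> ext_coboundaries P N i d"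
  shows "ext_cocycles Q N i d \<subseteq> ext_coboundaries Q N i d"
proof
  fix f assume "f \<in> ext_cocycles Q N i d"
  then have f: "f \<in> grhom (term_of Q i) N d" and fd: "\<And>v. f (diff Q i v) = 0"
    by (auto simp: ext_cocycles_def fun_eq_iff)
  obtain \<phi> \<psi> h where \<phi>: "chain_map Q P \<phi>" and \<psi>: "chain_map P Q \<psi>"
    and h: "homotopy_to_id Q (\<lambda>i. \<psi> i \<circ> \<phi> i) h"
    by (rule homotopy_equivalence[OF M Q P])
  note fm = graded_module_free
  have c: "\<psi> i (\<phi> i v) \<in> carr (term_of Q i)" if "v \<in> carr (term_of Q i)" for v
    by (rule grhom_carr[OF chain_map_grhom[OF \<psi>] grhom_carr[OF chain_map_grhom[OF \<phi>] that]])
  have fpsi: "f \<circ> \<psi> i \<in> ext_cocycles P N i d"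
    unfolding ext_cocycles_def mem_Collect_eq
  proof
    show "f \<circ> \<psi> i \<in> grhom (term_of P i) N d"
      using grhom_compose[OF fm chain_map_grhom[OF \<psi>] f] by simp
    show "f \<circ> \<psi> i \<circ> diff P i = 0"
    proof
      fix v show "(f \<circ> \<psi> i \<circ> diff P i) v = 0 v"
        using fd[of "\<psi> (Suc i) v"] chain_map_diff[OF \<psi>, of v i]
          grhom_outside[OF diff_grhom[OF P], of v i] grhom_zero[OF fm f]
          grhom_zero[OF fm chain_map_grhom[OF \<psi>]]
        by (cases "v \<in> carr (term_of P (Suc i))") simp_all
    qed
  qed
  show "f \<in> ext_coboundaries Q N i d"
  proof (cases i)
    case 0
    have "f \<circ> \<psi> 0 = 0" using fpsi van 0 by (auto simp: ext_coboundaries_def)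
    have "f v = 0" for v
    proof (cases "v \<in> carr (term_of Q 0)")
      case True
      then have "f v - f (\<psi> 0 (\<phi> 0 v)) = f (diff Q 0 (h 0 v))"
        using h grhom_diff[OF fm f, of v "\<psi> 0 (\<phi> 0 v)"] c[of v] 0 by (simp add: homotopy_to_id_def)
      then show ?thesis using fd 0 \<open>f \<circ> \<psi> 0 = 0\<close> by (simp add: fun_eq_iff)
    qed (use grhom_outside[OF f] 0 in auto)
    then show ?thesis using 0 by (auto simp: ext_coboundaries_def)
  next
    case (Suc j)
    then obtain g where g: "g \<in> grhom (term_of P j) N d" "f \<circ> \<psi> i = g \<circ> diff P j"
      using fpsi van by (auto simp: ext_coboundaries_def)
    have hj: "h j \<in> grhom (term_of Q j) (term_of Q i) 0" using h Suc by (simp add: homotopy_to_id_def)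
    \<comment> \<open>Since \<open>f\<close> kills boundaries, the homotopy expresses
      \<open>f\<close> as \<open>f \<circ> \<psi> i \<circ> \<phi> i\<close> plus
      \<open>f \<circ> h j \<circ> diff Q j\<close>. In the first summand
      \<open>f \<circ> \<psi> i = g \<circ> diff P j\<close>, and the differential moves past
      \<phi>.\<close>
    let ?k = "(g \<circ> \<phi> j) + (f \<circ> h j)"
    have k: "?k \<in> grhom (term_of Q j) N d"
      using grhom_plus[OF N] grhom_compose[OF fm chain_map_grhom[OF \<phi>] g(1)]
        grhom_compose[OF fm hj f] by simp
    have "f v = ?k (diff Q j v)" for v
    proof (cases "v \<in> carr (term_of Q i)")
      case True
      have dv: "diff Q j v \<in> carr (term_of Q j)"
        using grhom_carr[OF diff_grhom[OF Q]] True Suc by simp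
      have hc: "diff Q i (h i v) \<in> carr (term_of Q i)"
        using grhom_carr[OF diff_grhom[OF Q], of "h i v" i] h True
          grhom_carr[of "h i" "term_of Q i" "term_of Q (Suc i)"]
        by (auto simp: homotopy_to_id_def)
      have "f v - f (\<psi> i (\<phi> i v)) = f (v - \<psi> i (\<phi> i v))"
        using grhom_diff[OF fm f True c[OF True]] by simp
      also have "v - \<psi> i (\<phi> i v) = diff Q i (h i v) + h j (diff Q j v)"
        using h True Suc by (simp add: homotopy_to_id_def)
      also have "f \<dots> = f (h j (diff Q j v))"
        using grhom_add[OF f hc grhom_carr[OF hj dv]] fd by simp
      finally have "f v = f (\<psi> i (\<phi> i v)) + f (h j (diff Q j v))" by (simp add: algebra_simps)
      moreover have "f (\<psi> i (\<phi> i v)) = g (\<phi> j (diff Q j v))"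
        using fun_cong[OF g(2), of "\<phi> i v"] chain_map_diff[OF \<phi>, of v j] True Suc by simp
      ultimately show ?thesis by simp
    next
      case False
      \<comment> \<open>Outside the carrier both sides are 0 by the convention for
        \<open>grhom\<close>.\<close>
      then have "diff Q j v = 0" using grhom_outside[OF diff_grhom[OF Q], of v j] Suc by simp
      then show ?thesis using grhom_outside[OF f False] grhom_zero[OF fm k] by simp
    qed
    then have "f = ?k \<circ> diff Q j" unfolding o_def by (rule ext)
    then have "f \<in> (\<lambda>g. g \<circ> diff Q j) ` grhom (term_of Q j) N d" using k by (rule image_eqI)
    then show ?thesis using Suc by (simp add: ext_coboundaries_def)
  qed
qed

text \<open>The quotient consists of the cosets of \<open>H\<close> by elements of \<open>Z\<close>
  and its unit is \<open>H\<close>, so it is trivial exactly when every \<open>z\<close> is absorbed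
  by \<open>H\<close>. Nonvanishing of \<open>Tor\<close> and \<open>Ext\<close> thus becomes a
  failing inclusion.\<close>

lemma nonzero_quotient_iff:
  fixes H Z :: "'a::ab_group_add set"
  assumes H: "0 \<in> H" "\<And>a b. a \<in> H \<Longrightarrow> b \<in> H \<Longrightarrow> a - b \<in> H" and Z: "0 \<in> Z"
  shows "nonzero_group (additive_group Z Mod H) \<longleftrightarrow> \<not> Z \<subseteq> H"
proof -
  have coset: "H #>\<^bsub>additive_group Z\<^esub> z = (\<lambda>h. h + z) ` H" for z
    by (auto simp: r_coset_def additive_group_def)
  have "(\<lambda>h. h + z) ` H = H \<longleftrightarrow> z \<in> H" for z
  proof
    assume "(\<lambda>h. h + z) ` H = H"
    then show "z \<in> H" using H(1) by (metis add_0 image_eqI)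
  next
    assume z: "z \<in> H"
    have "h + z \<in> H" if "h \<in> H" for h
      using H(2)[OF that H(2)[OF H(1) z]] by simp
    moreover have "h \<in> (\<lambda>h. h + z) ` H" if "h \<in> H" for h
      using H(2)[OF that z] by (intro image_eqI[of _ _ "h - z"]) auto
    ultimately show "(\<lambda>h. h + z) ` H = H" by blast
  qed
  moreover have "f ` Z = {H} \<longleftrightarrow> (\<forall>z\<in>Z. f z = H)" for f :: "'a \<Rightarrow> 'a set"
    using Z by auto
  ultimately have "(\<lambda>z. (\<lambda>h. h + z) ` H) ` Z = {H} \<longleftrightarrow> Z \<subseteq> H"
    by (simp add: subset_eq)
  then show ?thesis
    unfolding nonzero_group_def carrier_FactGroup one_FactGroup coset
    by (simp add: additive_group_def)
qed

text \<open>The choice is legitimate once some resolution exists; the given one is the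
  witness.\<close>

lemma resolution_of_resolution:
  "graded_free_resolution M P \<Longrightarrow> graded_free_resolution M (resolution_of M)"
  unfolding resolution_of_def by (rule someI)

lemma zero_in_ext_coboundaries:
  assumes "graded_module N"
  shows "0 \<in> ext_coboundaries P N i d"
  using grhom_0[OF assms]
  by (auto simp: ext_coboundaries_def fun_eq_iff image_iff split: nat.split intro!: bexI[of _ 0])

text \<open>\<open>Ext\<close> is computed from an unspecified resolution; the transfer in both
  directions replaces it by \<open>P\<close>.\<close>

lemma nonzero_Ext_iff:
  assumes M: "graded_module M" and N: "graded_module N" and P: "graded_free_resolution M P"
  shows "nonzero_group (Ext M N i d) \<longleftrightarrow> \<not> ext_cocycles P N i d \<subseteq> ext_coboundaries P N i d"
proof -
  let ?P = "resolution_of M"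
  note R = resolution_of_resolution[OF P]
  have "nonzero_group (Ext M N i d) \<longleftrightarrow> \<not> ext_cocycles ?P N i d \<subseteq> ext_coboundaries ?P N i d"
    unfolding Ext_def
  proof (rule nonzero_quotient_iff)
    show "0 \<in> ext_coboundaries ?P N i d" by (rule zero_in_ext_coboundaries[OF N])
    show "a - b \<in> ext_coboundaries ?P N i d"
      if ab: "a \<in> ext_coboundaries ?P N i d" "b \<in> ext_coboundaries ?P N i d" for a b
    proof (cases i)
      case (Suc j)
      then obtain f g where "f \<in> grhom (term_of ?P j) N d" "g \<in> grhom (term_of ?P j) N d"
        "a = f \<circ> diff ?P j" "b = g \<circ> diff ?P j"
        using ab by (auto simp: ext_coboundaries_def)
      then show ?thesis using Suc grhom_minus[OF N, of f _ d g]
        by (auto simp: ext_coboundaries_def fun_eq_iff intro!: image_eqI[of _ _ "f - g"])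
    qed (use ab in \<open>auto simp: ext_coboundaries_def\<close>)
    show "0 \<in> ext_cocycles ?P N i d"
      using grhom_0[OF N] by (auto simp: ext_cocycles_def fun_eq_iff)
  qed
  then show ?thesis
    using ext_cocycles_coboundaries_transfer[OF M N R P] ext_cocycles_coboundaries_transfer[OF M N P R]
    by blast
qed


section \<open>Independence of Tor from the resolution\<close>

lemma tensor_map_0 [simp]: "tensor_map f 0 = 0"
  and tensor_map_minus: "tensor_map f (z - w) = tensor_map f z - tensor_map f w"
  and tensor_map_plus: "tensor_map f (z + w) = tensor_map f z + tensor_map f w"
  and tensor_map_frag_of [simp]: "tensor_map f (frag_of (a, n)) = frag_of (f a, n)"
  by (simp_all add: tensor_map_def frag_extend_diff frag_extend_add)

section \<open>Relations and degree components of tensor products\<close>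

lemma tensor_rel_zero [simp]: "0 \<in> tensor_rel A N"
  and tensor_rel_minus: "z \<in> tensor_rel A N \<Longrightarrow> w \<in> tensor_rel A N \<Longrightarrow> z - w \<in> tensor_rel A N"
  and tensor_rel_plus: "z \<in> tensor_rel A N \<Longrightarrow> w \<in> tensor_rel A N \<Longrightarrow> z + w \<in> tensor_rel A N"
  and tensor_rel_uminus: "- z \<in> tensor_rel A N \<longleftrightarrow> z \<in> tensor_rel A N"
  unfolding tensor_rel_def
  by (simp_all only: zero_in_group_closure group_closure.diff group_closure_add
    group_closure_minus_iff)

lemma tensor_rel_add_left: "a \<in> carr A \<Longrightarrow> a' \<in> carr A \<Longrightarrow> n \<in> carr N \<Longrightarrow>
    frag_of (a + a', n) - frag_of (a, n) - frag_of (a', n) \<in> tensor_rel A N"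
  unfolding tensor_rel_def by (rule group_closure.base) blast

lemma tensor_rel_add_right: "a \<in> carr A \<Longrightarrow> n \<in> carr N \<Longrightarrow> n' \<in> carr N \<Longrightarrow>
    frag_of (a, n + n') - frag_of (a, n) - frag_of (a, n') \<in> tensor_rel A N"
  unfolding tensor_rel_def by (rule group_closure.base) blast

lemma tensor_rel_smult: "a \<in> carr A \<Longrightarrow> n \<in> carr N \<Longrightarrow>
    frag_of (smult A p a, n) - frag_of (a, smult N p n) \<in> tensor_rel A N"
  unfolding tensor_rel_def by (rule group_closure.base) blast

lemma tensor_rel_zero_left:
  assumes "graded_module A" "n \<in> carr N" shows "frag_of (0, n) \<in> tensor_rel A N"
  using tensor_rel_add_left[OF carr_zero[OF assms(1)] carr_zero[OF assms(1)] assms(2)]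
  by (simp add: tensor_rel_uminus)

lemma tensor_rel_zero_right:
  assumes "0 \<in> carr N" "a \<in> carr A" shows "frag_of (a, 0) \<in> tensor_rel A N"
  using tensor_rel_add_right[OF assms(2,1,1)] by (simp add: tensor_rel_uminus)

lemma tensor_rel_induct [consumes 1, case_names zero add_left add_right smult minus]:
  assumes "z \<in> tensor_rel A N" and "Q 0"
    and "\<And>a a' n. a \<in> carr A \<Longrightarrow> a' \<in> carr A \<Longrightarrow> n \<in> carr N \<Longrightarrow>
      Q (frag_of (a + a', n) - frag_of (a, n) - frag_of (a', n))"
    and "\<And>a n n'. a \<in> carr A \<Longrightarrow> n \<in> carr N \<Longrightarrow> n' \<in> carr N \<Longrightarrow>
      Q (frag_of (a, n + n') - frag_of (a, n) - frag_of (a, n'))"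
    and "\<And>p a n. a \<in> carr A \<Longrightarrow> n \<in> carr N \<Longrightarrow>
      Q (frag_of (smult A p a, n) - frag_of (a, smult N p n))"
    and "\<And>z w. Q z \<Longrightarrow> Q w \<Longrightarrow> Q (z - w)"
  shows "Q z"
  using assms(1) unfolding tensor_rel_def
proof induction
  case (base s)
  then show ?case using assms(2-5) by blast
next
  case (diff s t)
  then show ?case using assms(6) by blast
qed

lemma tensor_comp_induct [consumes 1, case_names zero frag minus]:
  assumes "z \<in> tensor_comp A N d" and "Q 0"
    and "\<And>a n i j. i + j = d \<Longrightarrow> a \<in> comp A i \<Longrightarrow> n \<in> comp N j \<Longrightarrow> Q (frag_of (a, n))"
    and "\<And>z w. z \<in> tensor_comp A N d \<Longrightarrow> w \<in> tensor_comp A N d \<Longrightarrow> Q z \<Longrightarrow> Q w \<Longrightarrow> Q (z - w)"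
  shows "Q z"
  using assms(1) unfolding tensor_comp_def
proof induction
  case (base s)
  then show ?case using assms(2,3) by blast
next
  case (diff s t)
  then show ?case using assms(4) unfolding tensor_comp_def by blast
qed

lemma tensor_comp_zero [simp]: "0 \<in> tensor_comp A N d"
  and tensor_comp_minus: "z \<in> tensor_comp A N d \<Longrightarrow> w \<in> tensor_comp A N d \<Longrightarrow> z - w \<in> tensor_comp A N d"
  and tensor_comp_plus: "z \<in> tensor_comp A N d \<Longrightarrow> w \<in> tensor_comp A N d \<Longrightarrow> z + w \<in> tensor_comp A N d"
  unfolding tensor_comp_def
  by (simp_all only: zero_in_group_closure group_closure.diff group_closure_add)

lemma tensor_comp_frag_of:
  "a \<in> comp A i \<Longrightarrow> n \<in> comp N j \<Longrightarrow> frag_of (a, n) \<in> tensor_comp A N (i + j)"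
  unfolding tensor_comp_def by (rule group_closure.base) blast

section \<open>Functoriality of the tensor product\<close>

lemma tensor_map_rel:
  assumes f: "f \<in> grhom A B d" and z: "z \<in> tensor_rel A N"
  shows "tensor_map f z \<in> tensor_rel B N"
  using z
proof (induction rule: tensor_rel_induct)
  case (add_left a a' n)
  then show ?case
    using tensor_rel_add_left[OF grhom_carr[OF f] grhom_carr[OF f], of a a' n N]
    by (simp add: tensor_map_minus grhom_add[OF f])
next
  case (add_right a n n')
  then show ?case using tensor_rel_add_right[OF grhom_carr[OF f], of a n N n']
    by (simp add: tensor_map_minus)
next
  case (smult p a n)
  then show ?case using tensor_rel_smult[OF grhom_carr[OF f], of a n N p]
    by (simp add: tensor_map_minus grhom_smult[OF f])
qed (simp_all add: tensor_map_minus tensor_rel_minus)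

lemma tensor_map_comp:
  assumes f: "f \<in> grhom A B 0" and z: "z \<in> tensor_comp A N d"
  shows "tensor_map f z \<in> tensor_comp B N d"
  using z
proof (induction rule: tensor_comp_induct)
  case (frag a n i j)
  then show ?case using tensor_comp_frag_of[OF grhom_comp[OF f], of a i n N j] by simp
qed (simp_all add: tensor_map_minus tensor_comp_minus)

lemma tensor_map_cong:
  assumes "graded_module A" and "\<And>a. a \<in> carr A \<Longrightarrow> f a = g a" and z: "z \<in> tensor_comp A N d"
  shows "tensor_map f z = tensor_map g z"
  using z
  by (induction rule: tensor_comp_induct)
    (simp_all add: tensor_map_minus assms(2) comp_subset_carr[OF assms(1)])

lemma tensor_map_ident:
  assumes "z \<in> tensor_comp A N d"
  shows "tensor_map (\<lambda>a. a) z = z"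
  using assms by (induction rule: tensor_comp_induct) (simp_all add: tensor_map_minus)

lemma tensor_map_compose:
  assumes "z \<in> tensor_comp A N d"
  shows "tensor_map g (tensor_map f z) = tensor_map (g \<circ> f) z"
  using assms by (induction rule: tensor_comp_induct) (simp_all add: tensor_map_minus)

text \<open>On formal combinations of pairs \<open>tensor_map\<close> is not additive in the map:
  the pair \<open>(g a + h a, n)\<close> splits only modulo the relations.\<close>

lemma tensor_map_add_rel:
  assumes A: "graded_module A" and N: "\<And>d. comp N d \<subseteq> carr N"
    and g: "\<And>a. a \<in> carr A \<Longrightarrow> g a \<in> carr B" and h: "\<And>a. a \<in> carr A \<Longrightarrow> h a \<in> carr B"
    and f: "\<And>a. a \<in> carr A \<Longrightarrow> f a = g a + h a"
    and z: "z \<in> tensor_comp A N d"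
  shows "tensor_map f z - tensor_map g z - tensor_map h z \<in> tensor_rel B N"
  using z
proof (induction rule: tensor_comp_induct)
  case (frag a n i j)
  then have "a \<in> carr A" "n \<in> carr N" using comp_subset_carr[OF A] N by blast+
  then show ?case using tensor_rel_add_left[OF g h, of a a n N] by (simp add: f)
next
  case (minus z w)
  then show ?case using tensor_rel_minus[OF minus(3,4)] by (simp add: tensor_map_minus algebra_simps)
qed simp

text \<open>A cycle \<open>z\<close> is pushed along \<phi> to \<open>P\<close>, where it is the
  boundary of some \<open>y\<close> modulo the relations; \<psi> brings \<open>y\<close> back, and
  the homotopy accounts for the difference between \<open>z\<close> and its image under the
  composite.\<close>

lemma tor_cycles_boundaries_transfer:
  assumes M: "graded_module M" and N: "\<And>d. comp N d \<subseteq> carr N"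
    and Q: "graded_free_resolution M Q" and P: "graded_free_resolution M P"
    and van: "tor_cycles P N i d \<subseteq> tor_boundaries P N i d"
  shows "tor_cycles Q N i d \<subseteq> tor_boundaries Q N i d"
proof
  fix z assume z: "z \<in> tor_cycles Q N i d"
  then have zc: "z \<in> tensor_comp (term_of Q i) N d" by (simp add: tor_cycles_def)
  obtain \<phi> \<psi> h where \<phi>: "chain_map Q P \<phi>" and \<psi>: "chain_map P Q \<psi>"
    and h: "homotopy_to_id Q (\<lambda>i. \<psi> i \<circ> \<phi> i) h"
    by (rule homotopy_equivalence[OF M Q P])
  have hg: "h i \<in> grhom (term_of Q i) (term_of Q (Suc i)) 0" for i
    using h by (simp add: homotopy_to_id_def)
  note fm = graded_module_free and dQ = diff_grhom[OF Q]
    and fg = chain_map_grhom[OF \<phi>] and pg = chain_map_grhom[OF \<psi>]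
  have "tensor_map (\<phi> i) z \<in> tor_cycles P N i d"
  proof (cases i)
    case 0
    then show ?thesis using tensor_map_comp[OF fg zc] by (simp add: tor_cycles_def)
  next
    case (Suc j)
    have "tensor_map (diff P j) (tensor_map (\<phi> i) z) = tensor_map (diff P j \<circ> \<phi> i) z"
      by (rule tensor_map_compose[OF zc])
    also have "\<dots> = tensor_map (\<phi> j \<circ> diff Q j) z"
      using chain_map_diff[OF \<phi>] Suc by (intro tensor_map_cong[OF fm _ zc]) auto
    also have "\<dots> = tensor_map (\<phi> j) (tensor_map (diff Q j) z)"
      by (rule tensor_map_compose[OF zc, symmetric])
    also have "\<dots> \<in> tensor_rel (term_of P j) N"
      using z Suc by (intro tensor_map_rel[OF fg]) (simp add: tor_cycles_def)
    finally show ?thesis using tensor_map_comp[OF fg zc] Suc by (simp add: tor_cycles_def)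
  qed
  then obtain y where y: "y \<in> tensor_comp (term_of P (Suc i)) N d"
    and yr: "tensor_map (\<phi> i) z - tensor_map (diff P i) y \<in> tensor_rel (term_of P i) N"
    using van by (auto simp: tor_boundaries_def)
  let ?\<theta> = "\<psi> i \<circ> \<phi> i" and ?R = "tensor_rel (term_of Q i) N"
  have "tensor_map (\<psi> i) (tensor_map (diff P i) y) = tensor_map (\<psi> i \<circ> diff P i) y"
    by (rule tensor_map_compose[OF y])
  also have "\<dots> = tensor_map (diff Q i \<circ> \<psi> (Suc i)) y"
    using chain_map_diff[OF \<psi>] by (intro tensor_map_cong[OF fm _ y]) auto
  also have "\<dots> = tensor_map (diff Q i) (tensor_map (\<psi> (Suc i)) y)"
    by (rule tensor_map_compose[OF y, symmetric])
  finally have 1: "tensor_map ?\<theta> z - tensor_map (diff Q i) (tensor_map (\<psi> (Suc i)) y) \<in> ?R"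
    using tensor_map_rel[OF pg yr] by (simp add: tensor_map_minus tensor_map_compose[OF zc])
  have \<theta>c: "?\<theta> a \<in> carr (term_of Q i)" if "a \<in> carr (term_of Q i)" for a
    using grhom_carr[OF pg grhom_carr[OF fg that]] by simp
  have dhc: "(diff Q i \<circ> h i) a \<in> carr (term_of Q i)" if "a \<in> carr (term_of Q i)" for a
    using grhom_carr[OF dQ grhom_carr[OF hg that]] by simp
  \<comment> \<open>The homotopy identity after tensoring, modulo the relations. At a successor
    index the summand \<open>h j \<circ> diff Q j\<close> disappears because \<open>z\<close> is a
    cycle.\<close>
  have "z - tensor_map ?\<theta> z - tensor_map (diff Q i \<circ> h i) z \<in> ?R"
  proof (cases i)
    case 0
    have "tensor_map (\<lambda>a. a) z - tensor_map ?\<theta> z - tensor_map (diff Q i \<circ> h i) z \<in> ?R"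
      using h 0 by (intro tensor_map_add_rel[OF fm N \<theta>c dhc _ zc]) (auto simp: homotopy_to_id_def)
    then show ?thesis by (simp add: tensor_map_ident[OF zc])
  next
    case (Suc j)
    have hdc: "(h j \<circ> diff Q j) a \<in> carr (term_of Q i)" if "a \<in> carr (term_of Q i)" for a
      using grhom_carr[OF hg grhom_carr[OF dQ]] that Suc by simp
    let ?k = "(diff Q i \<circ> h i) + (h j \<circ> diff Q j)"
    have kc: "?k a \<in> carr (term_of Q i)" if "a \<in> carr (term_of Q i)" for a
      using carr_add[OF fm dhc[OF that] hdc[OF that]] by simp
    have "tensor_map (\<lambda>a. a) z - tensor_map ?\<theta> z - tensor_map ?k z \<in> ?R"
      using h Suc by (intro tensor_map_add_rel[OF fm N \<theta>c kc _ zc]) (auto simp: homotopy_to_id_def)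
    moreover have "tensor_map ?k z - tensor_map (diff Q i \<circ> h i) z - tensor_map (h j \<circ> diff Q j) z \<in> ?R"
      by (intro tensor_map_add_rel[OF fm N dhc hdc _ zc]) auto
    moreover have "tensor_map (h j \<circ> diff Q j) z \<in> ?R"
      using tensor_map_rel[OF hg[of j], of "tensor_map (diff Q j) z" N] z Suc
      by (simp add: tor_cycles_def flip: tensor_map_compose[OF zc])
    ultimately have "(tensor_map (\<lambda>a. a) z - tensor_map ?\<theta> z - tensor_map ?k z) +
        ((tensor_map ?k z - tensor_map (diff Q i \<circ> h i) z - tensor_map (h j \<circ> diff Q j) z) +
        tensor_map (h j \<circ> diff Q j) z) \<in> ?R"
      by (intro tensor_rel_plus)
    then show ?thesis by (simp add: tensor_map_ident[OF zc])
  qed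
  \<comment> \<open>The chain bounding \<open>z\<close> is the image of \<open>y\<close> under
    \<psi> plus the homotopy applied to \<open>z\<close>.\<close>
  from tensor_rel_plus[OF this 1]
  have "z - tensor_map (diff Q i) (tensor_map (\<psi> (Suc i)) y + tensor_map (h i) z) \<in> ?R"
    by (simp add: tensor_map_plus tensor_map_compose[OF zc] algebra_simps)
  moreover have "tensor_map (\<psi> (Suc i)) y + tensor_map (h i) z \<in> tensor_comp (term_of Q (Suc i)) N d"
    by (intro tensor_comp_plus tensor_map_comp[OF pg y] tensor_map_comp[OF hg zc])
  ultimately show "z \<in> tor_boundaries Q N i d"
    using zc unfolding tor_boundaries_def by blast
qed

lemma nonzero_Tor_iff:
  assumes M: "graded_module M" and N: "\<And>d. comp N d \<subseteq> carr N"
    and P: "graded_free_resolution M P"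
  shows "nonzero_group (Tor M N i d) \<longleftrightarrow> \<not> tor_cycles P N i d \<subseteq> tor_boundaries P N i d"
proof -
  let ?P = "resolution_of M"
  note R = resolution_of_resolution[OF P]
  have "nonzero_group (Tor M N i d) \<longleftrightarrow> \<not> tor_cycles ?P N i d \<subseteq> tor_boundaries ?P N i d"
    unfolding Tor_def
  proof (rule nonzero_quotient_iff)
    show "0 \<in> tor_boundaries ?P N i d"
      by (auto simp: tor_boundaries_def intro!: bexI[of _ 0])
    show "0 \<in> tor_cycles ?P N i d"
      by (auto simp: tor_cycles_def split: nat.split)
    fix a b assume "a \<in> tor_boundaries ?P N i d" "b \<in> tor_boundaries ?P N i d"
    then obtain u v where uv: "u \<in> tensor_comp (term_of ?P (Suc i)) N d"
        "v \<in> tensor_comp (term_of ?P (Suc i)) N d"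
      and r: "a - tensor_map (diff ?P i) u \<in> tensor_rel (term_of ?P i) N"
        "b - tensor_map (diff ?P i) v \<in> tensor_rel (term_of ?P i) N"
      and ab: "a \<in> tensor_comp (term_of ?P i) N d" "b \<in> tensor_comp (term_of ?P i) N d"
      unfolding tor_boundaries_def by blast
    have "a - b - tensor_map (diff ?P i) (u - v) \<in> tensor_rel (term_of ?P i) N"
      using tensor_rel_minus[OF r] by (simp add: tensor_map_minus algebra_simps)
    then show "a - b \<in> tor_boundaries ?P N i d"
      using tensor_comp_minus[OF uv] tensor_comp_minus[OF ab] unfolding tor_boundaries_def by blast
  qed
  then show ?thesis
    using tor_cycles_boundaries_transfer[OF M N R P] tor_cycles_boundaries_transfer[OF M N P R]
    by blast
qed


section \<open>Tor and Ext of a minimal resolution\<close>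

text \<open>The span is the product of the irrelevant ideal with the free module. Evaluation at the
  origin is multiplicative, so it kills all coordinates there.\<close>

lemma lookup_0_span_irrelevant:
  assumes "v \<in> Modules.module.span (smult (free_grmod ds))
    {smult (free_grmod ds) p u | p u. p \<in> irrelevant_ideal \<and> u \<in> carr (free_grmod ds)}"
  shows "Poly_Mapping.lookup (v j) 0 = 0"
proof -
  interpret Modules.module "smult (free_grmod ds)" by (rule module_free)
  show ?thesis using assms
  proof (induction rule: span_induct_alt)
    case base
    then show ?case by simp
  next
    case (step c x y)
    then obtain p u where "x = smult (free_grmod ds) p u" "p \<in> irrelevant_ideal" by blast
    then have "Poly_Mapping.lookup (x j) 0 = 0"
      by (simp add: free_grmod_def lookup_0_mult flip: lookup_0_eq_0_iff)
    then show ?case using step by (simp add: free_grmod_def lookup_add lookup_0_mult)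
  qed
qed

lemma minimal_diff_lookup_0:
  assumes "minimal_graded_free_resolution M F" "v \<in> carr (term_of F (Suc i))"
  shows "Poly_Mapping.lookup (diff F i v j) 0 = 0"
  using assms by (intro lookup_0_span_irrelevant[of _ "gens F i"])
    (auto simp: minimal_graded_free_resolution_def)

text \<open>Expanding \<open>v\<close> in the basis and moving each coordinate \<open>v j\<close>
  across the tensor sign turns it into its constant term, which is 0.\<close>

lemma residue_tensor_rel_frag:
  assumes v: "v \<in> carr (free_grmod ds)" "\<And>j. Poly_Mapping.lookup (v j) 0 = 0"
  shows "frag_of (v, c) \<in> tensor_rel (free_grmod ds) residue_grmod"
proof -
  let ?A = "free_grmod ds :: (('a, 'b) mpoly, nat \<Rightarrow> ('a, 'b) mpoly) grmod"
  let ?R = "tensor_rel ?A residue_grmod"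
  have carr_k: "x \<in> carr residue_grmod" for x :: 'b by (simp add: residue_grmod_def)
  \<comment> \<open>Partial sums are used because the additivity relation splits off one summand at
    a time.\<close>
  have "frag_of (\<Sum>j<k. smult ?A (v j) (basis_vec j), c) \<in> ?R" if "k \<le> length ds" for k
    using that
  proof (induction k)
    case 0
    show ?case using tensor_rel_zero_left[OF graded_module_free[of ds] carr_k[of c]] by (simp add: zero_fun_def)
  next
    case (Suc k)
    let ?s = "\<Sum>j<k. smult ?A (v j) (basis_vec j)" and ?t = "smult ?A (v k) (basis_vec k)"
    have bc: "basis_vec j \<in> carr ?A" if "j < Suc k" for j using that Suc(2) by (intro basis_vec_carr) simp
    have tc: "smult ?A (v j) (basis_vec j) \<in> carr ?A" if "j < Suc k" for j
      by (rule carr_smult[OF graded_module_free bc[OF that]])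
    have sc: "?s \<in> carr ?A" by (rule carr_sum[OF graded_module_free]) (simp add: tc)
    have "frag_of (?t, c) - frag_of (basis_vec k, smult residue_grmod (v k) c) \<in> ?R"
      by (rule tensor_rel_smult[OF bc carr_k]) simp
    moreover have "frag_of (basis_vec k, smult residue_grmod (v k) c) \<in> ?R"
      using tensor_rel_zero_right[OF carr_k bc] by (simp add: residue_grmod_def v(2))
    ultimately have "frag_of (?t, c) \<in> ?R" using tensor_rel_plus by fastforce
    from tensor_rel_plus[OF tensor_rel_plus[OF tensor_rel_add_left[OF sc tc carr_k, of k c] Suc.IH] this]
    show ?case using Suc(2) by (simp add: plus_fun_def)
  qed
  from this[of "length ds"] show ?thesis using free_expansion[OF v(1)] by simp
qed

text \<open>The \<open>j\<close>-th coordinate on \<open>F \<otimes> k\<close>, defined on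
  representatives: it extends the map sending \<open>v \<otimes> c\<close> to \<open>c\<close> times
  the constant term of \<open>v j\<close> additively.\<close>

definition residue_eval :: "nat \<Rightarrow> ((nat \<Rightarrow> ('x::finite, 'k::field) mpoly) \<times> 'k \<Rightarrow>\<^sub>0 int) \<Rightarrow> 'k" where
  "residue_eval j z = (\<Sum>x\<in>Poly_Mapping.keys z.
     of_int (Poly_Mapping.lookup z x) * (Poly_Mapping.lookup (fst x j) 0 * snd x))"

lemma residue_eval_superset:
  assumes "finite S" "Poly_Mapping.keys z \<subseteq> S"
  shows "residue_eval j z = (\<Sum>x\<in>S.
     of_int (Poly_Mapping.lookup z x) * (Poly_Mapping.lookup (fst x j) 0 * snd x))"
  unfolding residue_eval_def using assms by (intro sum.mono_neutral_left) (auto simp: in_keys_iff)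

lemma residue_eval_0 [simp]: "residue_eval j 0 = 0"
  by (simp add: residue_eval_def)

lemma residue_eval_frag_of [simp]:
  "residue_eval j (frag_of (v, c)) = Poly_Mapping.lookup (v j) 0 * c"
  by (simp add: residue_eval_def)

lemma residue_eval_minus: "residue_eval j (z - w) = residue_eval j z - residue_eval j w"
proof -
  let ?S = "Poly_Mapping.keys z \<union> Poly_Mapping.keys w"
  have "Poly_Mapping.keys (z - w) \<subseteq> ?S" by (auto simp: in_keys_iff lookup_minus)
  then show ?thesis
    by (simp add: residue_eval_superset[of ?S] lookup_minus algebra_simps sum_subtractf)
qed

text \<open>The coordinate descends to the tensor product; for the relation that moves scalars this
  is multiplicativity of the constant term.\<close>

lemma residue_eval_tensor_rel:
  assumes "z \<in> tensor_rel (free_grmod ds) residue_grmod"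
  shows "residue_eval j z = 0"
  using assms by (induction rule: tensor_rel_induct)
    (simp_all add: residue_eval_minus lookup_add distrib_left distrib_right,
      simp add: free_grmod_def residue_grmod_def lookup_0_mult)

lemma comp_residue_subset: "comp residue_grmod d \<subseteq> carr residue_grmod"
  by (simp add: residue_grmod_def)

text \<open>The differentials of \<open>F \<otimes> k\<close> vanish, so its homology is
  \<open>F \<otimes> k\<close> itself, with one basis element for each generator.\<close>

lemma minimal_tor_nonzero_iff:
  assumes F: "minimal_graded_free_resolution M F"
  shows "\<not> tor_cycles F residue_grmod i d \<subseteq> tor_boundaries F residue_grmod i d \<longleftrightarrow>
    d \<in> set (gens F i)"
proof
  assume "d \<in> set (gens F i)"
  then obtain j where j: "j < length (gens F i)" "gens F i ! j = d" by (auto simp: in_set_conv_nth)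
  let ?z = "frag_of (basis_vec j, 1)"
  have "?z \<in> tensor_comp (term_of F i) residue_grmod (d + 0)"
    using basis_vec_comp[OF j(1)] j(2) by (intro tensor_comp_frag_of) (auto simp: residue_grmod_def)
  moreover have "tensor_map (diff F l) ?z \<in> tensor_rel (term_of F l) residue_grmod" if "i = Suc l" for l
  proof -
    have d: "diff F l \<in> grhom (term_of F (Suc l)) (term_of F l) 0"
      using F by (intro diff_grhom[of M]) (simp add: minimal_graded_free_resolution_def)
    have c: "basis_vec j \<in> carr (term_of F (Suc l))" using basis_vec_carr[OF j(1)] that by simp
    show ?thesis
      using residue_tensor_rel_frag[OF grhom_carr[OF d c] minimal_diff_lookup_0[OF F c]] by simp
  qed
  ultimately have cyc: "?z \<in> tor_cycles F residue_grmod i d"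
    by (auto simp: tor_cycles_def split: nat.split)
  have "?z \<notin> tor_boundaries F residue_grmod i d"
  proof
    assume "?z \<in> tor_boundaries F residue_grmod i d"
    then obtain w where w: "w \<in> tensor_comp (term_of F (Suc i)) residue_grmod d"
      "?z - tensor_map (diff F i) w \<in> tensor_rel (term_of F i) residue_grmod"
      by (auto simp: tor_boundaries_def)
    \<comment> \<open>By minimality the \<open>j\<close>-th coordinate vanishes on boundaries, while
      it is 1 on \<open>?z\<close>.\<close>
    from w(1) have "residue_eval j (tensor_map (diff F i) w) = 0"
      by (induction rule: tensor_comp_induct)
        (simp_all add: residue_eval_minus tensor_map_minus minimal_diff_lookup_0[OF F]
          comp_subset_carr[OF graded_module_free])
    then show False
      using residue_eval_tensor_rel[OF w(2), of j]
      by (simp add: residue_eval_minus basis_vec_def)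
  qed
  with cyc show "\<not> tor_cycles F residue_grmod i d \<subseteq> tor_boundaries F residue_grmod i d" by blast
next
  assume "\<not> tor_cycles F residue_grmod i d \<subseteq> tor_boundaries F residue_grmod i d"
  then obtain z where z: "z \<in> tensor_comp (term_of F i) residue_grmod d"
    and nb: "z \<notin> tor_boundaries F residue_grmod i d"
    by (auto simp: tor_cycles_def)
  show "d \<in> set (gens F i)"
  proof (rule ccontr)
    assume d: "d \<notin> set (gens F i)"
    \<comment> \<open>Without a generator of degree \<open>d\<close>, the whole component of degree
      \<open>d\<close> of \<open>F \<otimes> k\<close> is zero.\<close>
    from z have "z \<in> tensor_rel (term_of F i) residue_grmod"
    proof (induction rule: tensor_comp_induct)
      case (frag a n e e')
      have ac: "a \<in> carr (term_of F i)" by (rule comp_subset_carr[OF graded_module_free frag(2)])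
      show ?case
      proof (cases "n = 0")
        case True
        have "0 \<in> carr residue_grmod" by (simp add: residue_grmod_def)
        from tensor_rel_zero_right[OF this ac] show ?thesis using True by simp
      next
        case False
        then have "e = d" using frag by (auto simp: residue_grmod_def split: if_splits)
        \<comment> \<open>The coordinate \<open>a l\<close> is homogeneous of degree
          \<open>d - gens F i ! l\<close>, which is nonzero, so it has no constant term.\<close>
        have "Poly_Mapping.lookup (a l) 0 = 0" for l
        proof (cases "l < length (gens F i)")
          case True
          then have "a l \<in> mpoly_comp (d - gens F i ! l)" "d \<noteq> gens F i ! l"
            using frag(2) \<open>e = d\<close> d by (auto simp: free_grmod_def)
          then show ?thesis by (simp add: lookup_0_mpoly_comp)
        next
          case False
          then show ?thesis using ac by (simp add: free_grmod_def)
        qed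
        with ac show ?thesis by (rule residue_tensor_rel_frag)
      qed
    qed (simp_all add: tensor_rel_minus)
    then have "z \<in> tor_boundaries F residue_grmod i d"
      using z unfolding tor_boundaries_def by (auto intro!: bexI[of _ 0])
    with nb show False ..
  qed
qed

text \<open>A map of degree \<open>d\<close> sends a generator of degree \<open>e\<close> to degree
  \<open>e + d\<close>. If all these degrees are negative the map is 0, hence a coboundary.\<close>

lemma ext_nonzero_degree_bound:
  assumes "\<not> ext_cocycles F ring_grmod i d \<subseteq> ext_coboundaries F ring_grmod i d"
  shows "\<exists>e\<in>set (gens F i). - d \<le> e"
proof (rule ccontr)
  assume neg: "\<not> ?thesis"
  obtain f where f: "f \<in> grhom (term_of F i) ring_grmod d"
    and nb: "f \<notin> ext_coboundaries F ring_grmod i d"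
    using assms by (auto simp: ext_cocycles_def)
  have "f v = 0" for v
  proof (cases "v \<in> carr (term_of F i)")
    case True
    have "f (basis_vec j) = 0" if j: "j < length (gens F i)" for j
    proof (rule mpoly_comp_negative)
      show "f (basis_vec j) \<in> mpoly_comp (gens F i ! j + d)"
        using grhom_comp[OF f basis_vec_comp[OF j]] by (simp add: ring_grmod_def)
      show "gens F i ! j + d < 0" using neg nth_mem[OF j] by (auto simp: not_le)
    qed
    then show ?thesis using grhom_free_expansion[OF f True] by (simp add: ring_grmod_def)
  qed (rule grhom_outside[OF f])
  then have "f = 0" by (simp add: fun_eq_iff)
  then show False using nb zero_in_ext_coboundaries[OF graded_module_ring_grmod] by blast
qed

text \<open>The cocycle is the dual basis vector of the \<open>j\<close>-th generator: degree reasons and minimality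
  make it vanish on boundaries, and minimality also prevents it from being a coboundary.\<close>

lemma minimal_ext_nonzero:
  assumes F: "minimal_graded_free_resolution M F"
    and j: "j < length (gens F i)"
    and le: "\<And>e. e \<in> set (gens F (Suc i)) \<Longrightarrow> e \<le> gens F i ! j"
  shows "\<not> ext_cocycles F ring_grmod i (- (gens F i ! j)) \<subseteq>
    ext_coboundaries F ring_grmod i (- (gens F i ! j))"
proof -
  let ?b = "gens F i ! j"
  have d: "diff F l \<in> grhom (term_of F (Suc l)) (term_of F l) 0" for l
    using F by (intro diff_grhom[of M]) (simp add: minimal_graded_free_resolution_def)
  define f where "f = (\<lambda>v. if v \<in> carr (term_of F i) then v j else 0)"
  note fm = graded_module_free
  have f: "f \<in> grhom (term_of F i) ring_grmod (- ?b)"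
    unfolding grhom_def mem_Collect_eq
  proof (intro conjI allI ballI impI)
    fix p v assume v: "v \<in> carr (term_of F i)"
    then show "f (smult (term_of F i) p v) = smult ring_grmod p (f v)"
      using carr_smult[OF fm v, of p] by (simp add: f_def) (simp add: free_grmod_def ring_grmod_def)
  next
    fix e v assume v: "v \<in> comp (term_of F i) e"
    then show "f v \<in> comp ring_grmod (e + - ?b)"
      using comp_subset_carr[OF fm v] j by (simp add: f_def) (simp add: free_grmod_def ring_grmod_def)
  qed (simp_all add: f_def carr_add[OF fm], simp add: ring_grmod_def)
  have fd: "f \<circ> diff F i \<in> grhom (term_of F (Suc i)) ring_grmod (- ?b)"
    using grhom_compose[OF fm d f] by simp
  have fd0: "f (diff F i (basis_vec l)) = 0" if l: "l < length (gens F (Suc i))" for l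
  proof -
    let ?p = "f (diff F i (basis_vec l))"
    have p: "?p \<in> mpoly_comp (gens F (Suc i) ! l - ?b)"
      using grhom_comp[OF fd basis_vec_comp[OF l]] by (simp add: ring_grmod_def)
    show ?thesis
    proof (cases "gens F (Suc i) ! l = ?b")
      case True
      \<comment> \<open>In this case \<open>?p\<close> has degree 0, so it is determined by its
        constant term, which minimality makes 0.\<close>
      have "Poly_Mapping.lookup ?p 0 = 0"
        using minimal_diff_lookup_0[OF F basis_vec_carr[OF l]] by (simp add: f_def)
      then show ?thesis using mpoly_comp_0_eq_0 p True by fastforce
    next
      case False
      then have "gens F (Suc i) ! l - ?b < 0" using le[of "gens F (Suc i) ! l"] l by simp
      with p show ?thesis by (rule mpoly_comp_negative)
    qed
  qed
  have "f (diff F i v) = 0" for v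
  proof (cases "v \<in> carr (term_of F (Suc i))")
    case True
    then show ?thesis using grhom_free_expansion[OF fd True] fd0 by (simp add: ring_grmod_def)
  next
    case False
    then show ?thesis using grhom_outside[OF fd False] by simp
  qed
  then have "f \<in> ext_cocycles F ring_grmod i (- ?b)"
    using f by (simp add: ext_cocycles_def fun_eq_iff)
  moreover have "f \<notin> ext_coboundaries F ring_grmod i (- ?b)"
  proof
    assume cob: "f \<in> ext_coboundaries F ring_grmod i (- ?b)"
    have one: "f (basis_vec j) = 1"
      using basis_vec_carr[OF j] by (simp add: f_def) (simp add: basis_vec_def)
    show False
    proof (cases i)
      case 0
      then show False using cob one by (simp add: ext_coboundaries_def)
    next
      case (Suc l)
      then obtain g where g: "g \<in> grhom (term_of F l) ring_grmod (- ?b)" "f = g \<circ> diff F l"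
        using cob by (auto simp: ext_coboundaries_def)
      have c: "basis_vec j \<in> carr (term_of F (Suc l))" using basis_vec_carr[OF j] Suc by simp
      \<comment> \<open>By minimality all coordinates of the differential lack a constant term,
        hence so does every linear combination of them, whereas \<open>f\<close> takes the value 1
        here.\<close>
      have "Poly_Mapping.lookup (g (diff F l (basis_vec j))) 0 = 0"
        unfolding grhom_free_expansion[OF g(1) grhom_carr[OF d c]]
        by (simp add: ring_grmod_def lookup_sum lookup_0_mult minimal_diff_lookup_0[OF F c])
      moreover have "g (diff F l (basis_vec j)) = 1" using one g(2) by simp
      ultimately show False by simp
    qed
  qed
  ultimately show ?thesis by blast
qed


section \<open>The regularity as a maximum\<close>

text \<open>Beyond \<open>s\<close> there are no generators and every entry is
  \<open>-\<infinity>\<close>, so only the indices up to \<open>s\<close> matter. Finiteness gives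
  \<open>Max\<close> its meaning.\<close>

lemma finite_reg_set:
  assumes "\<forall>i>s. gens P i = []"
  shows "finite {max_gen_degree P i - ereal (real i) | i. True}"
    and "finite {t. \<exists>i. t + int i \<in> set (gens P i)}"
proof -
  have "max_gen_degree P i - ereal (real i) = -\<infinity>" if "i > s" for i
    using that assms by (simp add: max_gen_degree_def)
  then have "{max_gen_degree P i - ereal (real i) | i. True} \<subseteq>
      insert (-\<infinity>) ((\<lambda>i. max_gen_degree P i - ereal (real i)) ` {..s})"
    by (auto simp: not_le[symmetric])
  then show "finite {max_gen_degree P i - ereal (real i) | i. True}"
    by (rule finite_subset) simp
  have "i \<le> s" if "t + int i \<in> set (gens P i)" for t i
    using that assms by (cases "s < i") auto
  then have "{t. \<exists>i. t + int i \<in> set (gens P i)} \<subseteq> (\<Union>i\<le>s. (\<lambda>e. e - int i) ` set (gens P i))"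
    by (force simp: image_iff)
  then show "finite {t. \<exists>i. t + int i \<in> set (gens P i)}"
    by (rule finite_subset) simp
qed

text \<open>The iterated maximum in \<open>reg\<close> is flattened to one over all shifted
  generator degrees, the form to which \<open>Tor\<close> and \<open>Ext\<close> are
  compared.\<close>

lemma is_max_reg:
  assumes s: "\<forall>i>s. gens P i = []"
  shows "is_max {t. \<exists>i. t + int i \<in> set (gens P i)} (reg P)"
proof (cases "{t. \<exists>i. t + int i \<in> set (gens P i)} = {}")
  case True
  have "gens P i = []" for i
  proof (rule ccontr)
    assume "gens P i \<noteq> []"
    then have "(hd (gens P i) - int i) + int i \<in> set (gens P i)" by simp
    then show False using True by blast
  qed
  \<comment> \<open>All terms of the resolution are zero, so every entry is
    \<open>-\<infinity>\<close>, the value that \<open>is_max\<close> assigns to the empty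
    set.\<close>
  then have "{max_gen_degree P i - ereal (real i) | i. True} = {-\<infinity>}"
    by (auto simp: max_gen_degree_def)
  then have "reg P = -\<infinity>" unfolding reg_def by simp
  then show ?thesis unfolding is_max_def True by simp
next
  case False
  let ?S = "{t. \<exists>i. t + int i \<in> set (gens P i)}"
  note fin = finite_reg_set[OF s]
  define m where "m = Max ?S"
  have mS: "m \<in> ?S" and mle: "\<forall>t\<in>?S. t \<le> m"
    using Max_in[OF fin(2) False] Max_ge[OF fin(2)] by (auto simp: m_def)
  have le: "Max (set (gens P i)) \<le> m + int i" if "gens P i \<noteq> []" for i
  proof -
    have "(Max (set (gens P i)) - int i) + int i \<in> set (gens P i)" using that by simp
    then have "Max (set (gens P i)) - int i \<le> m" using mle by blast
    then show ?thesis by simp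
  qed
  have "reg P = ereal (of_int m)"
    unfolding reg_def
  proof (rule Max_eqI[OF fin(1)])
    fix y assume "y \<in> {max_gen_degree P i - ereal (real i) | i. True}"
    then obtain i where y: "y = max_gen_degree P i - ereal (real i)" by blast
    show "y \<le> ereal (of_int m)"
    proof (cases "gens P i = []")
      case False
      from le[OF this] have "real_of_int (Max (set (gens P i))) \<le> of_int m + real i" by linarith
      then show ?thesis using False y by (simp add: max_gen_degree_def)
    qed (simp add: y max_gen_degree_def)
  next
    obtain i where i: "m + int i \<in> set (gens P i)" using mS by blast
    then have "gens P i \<noteq> []" by auto
    moreover have "m + int i \<le> Max (set (gens P i))" using i by simp
    ultimately have "Max (set (gens P i)) = m + int i" using le[of i] by (intro antisym)
    then have "max_gen_degree P i - ereal (real i) = ereal (of_int m)"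
      using \<open>gens P i \<noteq> []\<close> by (simp add: max_gen_degree_def)
    then show "ereal (of_int m) \<in> {max_gen_degree P i - ereal (real i) | i. True}" by (metis (mono_tags, lifting) mem_Collect_eq)
  qed
  then show ?thesis using False mS mle unfolding is_max_def by auto
qed

text \<open>Attainment is asked only at the maximum of \<open>S\<close>, since a generator of
  smaller shifted degree need not give a nonzero class in \<open>Ext\<close>.\<close>

lemma is_max_cofinal:
  assumes S: "is_max S r" and le: "\<And>t. t \<in> T \<Longrightarrow> \<exists>s\<in>S. t \<le> s"
    and att: "\<And>m. m \<in> S \<Longrightarrow> (\<And>s. s \<in> S \<Longrightarrow> s \<le> m) \<Longrightarrow> m \<in> T"
  shows "is_max T r"
proof (cases "S = {}")
  case True
  then have "T = {}" using le by blast
  then show ?thesis using S True by (simp add: is_max_def)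
next
  case False
  then obtain m where m: "m \<in> S" "\<And>s. s \<in> S \<Longrightarrow> s \<le> m" "r = ereal (of_int m)"
    using S by (auto simp: is_max_def)
  then have "m \<in> T" using att by blast
  moreover have "t \<le> m" if "t \<in> T" for t using le[OF that] m(2) by force
  ultimately show ?thesis using m(3) by (auto simp: is_max_def)
qed

theorem proposition1p1:
  fixes M :: "(('x::finite, 'k::field) mpoly, 'm::ab_group_add) grmod"
    and F :: "(('x, 'k) mpoly, 'm) gfree_complex"
  assumes "graded_module M"
    and "finitely_generated M"
    and "minimal_graded_free_resolution M F"
  shows "is_max {t. \<exists>i. nonzero_group (Tor M residue_grmod i (t + int i))} (reg F) \<and>
         is_max {t. \<exists>i. nonzero_group (Ext M ring_grmod i (- t - int i))} (reg F)"
proof -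
  note M = assms(1) and F = assms(3)
  have P: "graded_free_resolution M F" using F by (simp add: minimal_graded_free_resolution_def)
  obtain s where s: "\<forall>i>s. gens F i = []" using F by (auto simp: minimal_graded_free_resolution_def)
  \<comment> \<open>With \<open>d = t + int i\<close>, this rewrites the set for \<open>Tor\<close>
    into exactly the set of shifted generator degrees.\<close>
  note Tor = nonzero_Tor_iff[OF M comp_residue_subset P, unfolded minimal_tor_nonzero_iff[OF F]]
  note Ext = nonzero_Ext_iff[OF M graded_module_ring_grmod P]
  note reg = is_max_reg[OF s]
  have "is_max {t. \<exists>i. nonzero_group (Ext M ring_grmod i (- t - int i))} (reg F)"
  proof (rule is_max_cofinal[OF reg])
    fix t assume "t \<in> {t. \<exists>i. nonzero_group (Ext M ring_grmod i (- t - int i))}"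
    then obtain i where "nonzero_group (Ext M ring_grmod i (- t - int i))" by blast
    then obtain e where e: "e \<in> set (gens F i)" "- (- t - int i) \<le> e"
      unfolding Ext using ext_nonzero_degree_bound by blast
    then show "\<exists>s\<in>{t. \<exists>i. t + int i \<in> set (gens F i)}. t \<le> s"
      by (intro bexI[of _ "e - int i"]) (auto intro!: exI[of _ i])
  next
    fix m assume m: "m \<in> {t. \<exists>i. t + int i \<in> set (gens F i)}"
      and max: "\<And>s. s \<in> {t. \<exists>i. t + int i \<in> set (gens F i)} \<Longrightarrow> s \<le> m"
    \<comment> \<open>The last index at which the maximum is attained; it exists because such
      indices are bounded by \<open>s\<close>. Hence the next term has no generator of degree
      \<open>m + i + 1\<close>.\<close>
    define i where "i = (GREATEST i. m + int i \<in> set (gens F i))"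
    have bound: "\<And>k. m + int k \<in> set (gens F k) \<Longrightarrow> k \<le> s"
      using s by (metis empty_iff empty_set not_le)
    have i: "m + int i \<in> set (gens F i)"
      unfolding i_def using m
      by (intro GreatestI_ex_nat[where P = "\<lambda>k. m + int k \<in> set (gens F k)", OF _ bound]) auto
    have last: "m + int (Suc i) \<notin> set (gens F (Suc i))"
      using Greatest_le_nat[where P = "\<lambda>k. m + int k \<in> set (gens F k)", OF _ bound, of "Suc i"]
      unfolding i_def[symmetric] by auto
    obtain j where j: "j < length (gens F i)" "gens F i ! j = m + int i"
      using i by (auto simp: in_set_conv_nth)
    \<comment> \<open>Maximality of \<open>m\<close> gives \<open>e \<le> m + i + 1\<close>, and the
      choice of \<open>i\<close> excludes equality, so \<open>e \<le> m + i\<close>.\<close>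
    have "e \<le> gens F i ! j" if e: "e \<in> set (gens F (Suc i))" for e
    proof -
      have "e - int (Suc i) \<le> m" using e by (intro max) (auto intro!: exI[of _ "Suc i"])
      moreover have "e \<noteq> m + int (Suc i)" using e last by blast
      ultimately show ?thesis using j(2) by simp
    qed
    from minimal_ext_nonzero[OF F j(1) this]
    have "nonzero_group (Ext M ring_grmod i (- m - int i))" unfolding Ext j(2) by simp
    then show "m \<in> {t. \<exists>i. nonzero_group (Ext M ring_grmod i (- t - int i))}" by blast
  qed
  then show ?thesis using reg unfolding Tor by blast
qed

end
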